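(* In the setting of the stochastic APP algorithm described in the context, assume: (a) (linearly bounded subgradients) there exist $c_1,c_2>0$ such that $\|r\|_\star\le c_1\|u\|+c_2$ for all $(u,w)\in U^{\mathrm{ad}}\times\mathbb{W}$ and all $r\in\partial_u j^{C}(u,w)$, and there exist $d_1,d_2>0$ such that $\|s\|_\star\le d_1\|u\|+d_2$ for all $(u,w)\in U^{\mathrm{ad}}\times\mathbb{W}$ and all $s\in\partial_u j^{\Sigma}(u,w)$; (b) $J$ is coercive on $U^{\mathrm{ad}}$; (c) $K$ is $b$-strongly convex for some $b>0$, i.e. $K(v)\ge K(u)+\langle\nabla K(u),v-u\rangle+\frac b2\|u-v\|^2$ for all $u,v\in\mathbb{U}$, and $\nabla K$ is $L_K$-Lipschitz for some $L_K>0$, i.e. $\|\nabla K(v)-\nabla K(u)\|_\star\le L_K\|v-u\|$ for all $u,v\in\mathbb{U}$; (d) $\varepsilon_k>0$ for all $k$, $\sum_k\varepsilon_k=+\infty$ and $\sum_k\varepsilon_k^2<+\infty$; (e) each $\mathbf{R}_k$ is $\mathcal{F}_{k+1}$-measurable, the sequence $\{\mathbf{R}_k\}_{k\in\mathbb{N}}$ is $\mathbb{P}$-almost surely bounded, and $\sum_{k\in\mathbb{N}}\varepsilon_k\,\mathbb{E}\big(\|\mathbf{R}_k\|_\star\mid\mathcal{F}_k\big)<+\infty$ $\mathbb{P}$-almost surely; (f) for every integer $k\ge1$ there is an integrable $\psi_k:\Omega\to\mathbb{R}$ such that $\psi_k(\cdot)\le(j^{C}+j^{\Sigma})(u,\mathbf{W}_k(\cdot))$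 for all $u\in\mathbb{U}$; (g) with $Q_k=\operatorname{ess\,sup}_{\omega\in\Omega}\|\mathbf{R}_k(\omega)\|_\star$, one has $\sum_{k\in\mathbb{N}}Q_k\varepsilon_k<\infty$. For integers $1\le i\le n$ define the averaged iterate $\widetilde{\mathbf{U}}_i^n=\sum_{k=i}^n\eta_k^i\mathbf{U}_k$ with $\eta_k^i=\varepsilon_k\big/\sum_{l=i}^n\varepsilon_l$. Suppose that $\varepsilon_k=ck^{-\theta}$ for all $k\ge1$, with $1/2<\theta<1$ and a constant $c>0$. Then for any minimizer $u^\sharp$ of $J$ over $U^{\mathrm{ad}}$, $$\mathbb{E}\big(J(\widetilde{\mathbf{U}}_1^n)-J(u^\sharp)\big)=\mathcal{O}(n^{\theta-1})\quad\text{as }n\to\infty.$$ In particular, the rate of convergence can be made arbitrarily close to the order $n^{-1/2}$ by choosing $\theta$ arbitrarily close to $1/2$.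
   Context: Setting. $\mathbb{U}$ is a reflexive separable Banach space with norm $\|\cdot\|$, dual $\mathbb{U}^\star$, dual norm $\|\cdot\|_\star$, duality pairing $\langle\cdot,\cdot\rangle$; $(\Omega,\mathcal{A},\mathbb{P})$ is a probability space with $\mathcal{A}$ complete for $\mathbb{P}$; $\mathbb{W}$ is a topological vector space with its Borel $\sigma$-field; $U^{\mathrm{ad}}\subset\mathbb{U}$ is non-empty, closed, convex. $j^{C},j^{\Sigma}:\mathbb{U}\times\mathbb{W}\to\mathbb{R}$ are jointly lower semicontinuous; for all $w$, $j^{C}(\cdot,w)$ and $j^{\Sigma}(\cdot,w)$ are proper and convex, and $j^{C}(\cdot,w)$ is subdifferentiable on an open set containing $U^{\mathrm{ad}}$. $K:\mathbb{U}\to\mathbb{R}$ is convex, lower semicontinuous and Gateaux-differentiable (on an open set containing $U^{\mathrm{ad}}$, and everywhere where $\nabla K$ is used). $\mathbf{W}:\Omega\to\mathbb{W}$ is a random variable, $J^{C}(u)=\mathbb{E}(j^{C}(u,\mathbf{W}))$, $J^{\Sigma}(u)=\mathbb{E}(j^{\Sigma}(u,\mathbf{W}))$, $J=J^{C}+J^{\Sigma}$; these expectations are understood to be well defined, with $J$ finite on $U^{\mathrm{ad}}$. The problem is $\min_{u\in U^{\mathrm{ad}}}J(u)$ (its solution set is non-empty under coercivity of $J$). A function is coercive on $U^{\mathrm{ad}}$ if it tends to $+\infty$ when $\|u\|\to+\infty$, $u\in U^{\mathrm{ad}}$. Algorithm. $\mathbf{W}_1,\mathbf{W}_2,\ldots$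 are independent random variables distributed as $\mathbf{W}$, $\mathcal{F}_k=\sigma(\mathbf{W}_1,\ldots,\mathbf{W}_k)$; $\varepsilon_k>0$ are step sizes; $\mathbf{R}_k:\Omega\to\mathbb{U}^\star$ are measurable (additive errors). $\mathbf{U}_0\equiv u_0\in U^{\mathrm{ad}}$ and, for $k\in\mathbb{N}$, $\mathbf{G}_k:\Omega\to\mathbb{U}^\star$ is measurable with $\mathbf{G}_k(\omega)\in\partial_u j^{C}(\mathbf{U}_k(\omega),\mathbf{W}_{k+1}(\omega))$ for all $\omega$, and $\mathbf{U}_{k+1}(\omega)$ is the unique (as $K$ is strongly convex) minimizer over $u\in U^{\mathrm{ad}}$ of $$K(u)+\big\langle\varepsilon_k(\mathbf{G}_k(\omega)+\mathbf{R}_k(\omega))-\nabla K(\mathbf{U}_k(\omega)),u\big\rangle+\varepsilon_k\,j^{\Sigma}(u,\mathbf{W}_{k+1}(\omega)),$$ this function being coercive on $U^{\mathrm{ad}}$ for all $k$ and $\omega$. The iterates are adapted: $\mathbf{U}_k$ is $\mathcal{F}_k$-measurable for all $k$. *)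

theory Defs
  imports "HOL-Probability.Probability" "HOL-Library.Landau_Symbols"
begin

text \<open>
  The dual space of \<open>'u\<close> is the type of bounded linear functionals \<open>'u \<Rightarrow>\<^sub>L real\<close>,
  whose norm is the dual norm and whose application is the duality pairing.
\<close>

class real_topological_vector_space = real_vector + topological_ab_group_add +
  assumes tendsto_scaleR_Pair:
    "LIM x (nhds r \<times>\<^sub>F nhds v). fst x *\<^sub>R snd x :> nhds (r *\<^sub>R v)"

definition reflexive_space :: "'u::real_normed_vector itself \<Rightarrow> bool" where
  "reflexive_space _ \<longleftrightarrow>
     (\<forall>\<phi> :: ('u \<Rightarrow>\<^sub>L real) \<Rightarrow>\<^sub>L real. \<exists>u :: 'u. \<forall>f. blinfun_apply \<phi> f = blinfun_apply f u)"

definition lower_semicontinuous :: "('x::topological_space \<Rightarrow> real) \<Rightarrow> bool" where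
  "lower_semicontinuous f \<longleftrightarrow> (\<forall>x. \<forall>a < f x. eventually (\<lambda>y. a < f y) (nhds x))"

definition subdifferential :: "('u::real_normed_vector \<Rightarrow> real) \<Rightarrow> 'u \<Rightarrow> ('u \<Rightarrow>\<^sub>L real) set" where
  "subdifferential f u = {r. \<forall>v. f u + blinfun_apply r (v - u) \<le> f v}"

definition has_gateaux_derivative ::
  "('u::real_normed_vector \<Rightarrow> real) \<Rightarrow> ('u \<Rightarrow>\<^sub>L real) \<Rightarrow> 'u \<Rightarrow> bool" where
  "has_gateaux_derivative f g u \<longleftrightarrow>
     (\<forall>h. ((\<lambda>t. (f (u + t *\<^sub>R h) - f u) / t) \<longlongrightarrow> blinfun_apply g h) (at 0))"

definition coercive_on :: "'u::real_normed_vector set \<Rightarrow> ('u \<Rightarrow> real) \<Rightarrow> bool" where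
  "coercive_on S f \<longleftrightarrow> filterlim f at_top (inf at_infinity (principal S))"

definition expected_cost :: "'a measure \<Rightarrow> ('a \<Rightarrow> 'w) \<Rightarrow> ('u \<Rightarrow> 'w \<Rightarrow> real) \<Rightarrow> 'u \<Rightarrow> real" where
  "expected_cost M W j u = (\<integral>\<omega>. j u (W \<omega>) \<partial>M)"

text \<open>
  The sigma-algebra generated by the samples \<open>X 1, \<dots>, X k\<close> (trivial for \<open>k = 0\<close>; the value
  \<open>X 0\<close> never enters).
\<close>

definition sample_algebra ::
  "'a measure \<Rightarrow> (nat \<Rightarrow> 'a \<Rightarrow> 'w::topological_space) \<Rightarrow> nat \<Rightarrow> 'a measure" where
  "sample_algebra M X k =
     sigma (space M) (\<Union>i\<in>{1..k}. {X i -` A \<inter> space M | A. A \<in> sets borel})"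

text \<open>
  The auxiliary objective, with \<open>\<nabla>K\<close> given as \<open>dK\<close>, current iterate \<open>u\<^sub>k\<close>, step size \<open>\<epsilon>\<close>,
  perturbed gradient \<open>g\<close> and sample value \<open>w\<close>.
\<close>

definition app_objective ::
  "('u::real_normed_vector \<Rightarrow> real) \<Rightarrow> ('u \<Rightarrow> 'u \<Rightarrow>\<^sub>L real) \<Rightarrow> ('u \<Rightarrow> 'w \<Rightarrow> real) \<Rightarrow>
   'u \<Rightarrow> real \<Rightarrow> ('u \<Rightarrow>\<^sub>L real) \<Rightarrow> 'w \<Rightarrow> 'u \<Rightarrow> real" where
  "app_objective K dK jS u\<^sub>k \<epsilon> g w u =
     K u + blinfun_apply (\<epsilon> *\<^sub>R g - dK u\<^sub>k) u + \<epsilon> * jS u w"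

definition averaged_iterate ::
  "(nat \<Rightarrow> real) \<Rightarrow> (nat \<Rightarrow> 'a \<Rightarrow> 'u::real_vector) \<Rightarrow> nat \<Rightarrow> nat \<Rightarrow> 'a \<Rightarrow> 'u" where
  "averaged_iterate \<epsilon> U i n \<omega> = (\<Sum>k=i..n. (\<epsilon> k / (\<Sum>l=i..n. \<epsilon> l)) *\<^sub>R U k \<omega>)"

end

theory Submission
  imports Defs
begin

text \<open>
  The proof follows the Bregman divergence \<open>V k = K u\<^sup>\<sharp> - K (U k) - \<langle>\<nabla>K (U k), u\<^sup>\<sharp> - U k\<rangle>\<close> of the
  minimizer \<open>u\<^sup>\<sharp>\<close> from the iterates. Write \<open>j = jC + jS\<close>. The variational inequality that characterizes
  \<open>U (k+1)\<close> and the strong convexity of \<open>K\<close> give, almost surely,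
  \<open>V (k+1) + \<epsilon> k (j (U k) W - j u\<^sup>\<sharp> W) \<le> (1 + a k) V k + r k\<close> with \<open>W\<close> the sample of index \<open>k+1\<close>
  and deterministic summable \<open>a\<close> and \<open>r\<close> (\<open>one_step_decrease\<close>, \<open>absorb_into_energy\<close>). Summability
  comes from square-summability of the steps and from the summability of \<open>\<epsilon> k\<close> times the essential
  supremum of the \<open>k\<close>-th error.

  The iterate \<open>U k\<close> is independent of that sample, so the cost gap on the sample has mean
  \<open>E (J (U k) - J u\<^sup>\<sharp>)\<close>, which is nonnegative (\<open>expectation_fresh_sample_gap\<close>). A discrete
  Gronwall argument then bounds \<open>\<Sum>k. \<epsilon> k * E (J (U k) - J u\<^sup>\<sharp>)\<close> by a constant
  (\<open>expected_energy_recursion\<close>). Convexity of \<open>J\<close> bounds the expected gap of the averaged iterate by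
  this constant divided by \<open>\<epsilon> 1 + ... + \<epsilon> n\<close>, and for \<open>\<epsilon> k = c k\<^sup>-\<^sup>\<theta>\<close> this sum is at least
  \<open>c n\<^sup>1\<^sup>-\<^sup>\<theta>\<close>.

  One point needs functional analysis. The variational inequality involves \<open>jS (U (k+1)) W\<close>, where
  iterate and sample are dependent, and passing to \<open>jS (U k) W\<close> requires a Lipschitz estimate. The
  hypotheses bound the subgradients of \<open>jS\<close> without saying that there are any. They exist because a
  finite lower semicontinuous convex function on a Banach space is locally bounded above (Baire) and
  its directional derivative dominates a linear functional (Hahn-Banach), which is then continuous.
\<close>

section \<open>Sublinear functionals and the Hahn-Banach theorem\<close>

definition sublinear :: "('u::real_vector \<Rightarrow> real) \<Rightarrow> bool" where
  "sublinear q \<longleftrightarrow> (\<forall>x y. q (x + y) \<le> q x + q y) \<and> (\<forall>t>0. \<forall>x. q (t *\<^sub>R x) \<le> t * q x)"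

lemma sublinear_add: "sublinear q \<Longrightarrow> q (x + y) \<le> q x + q y"
  by (simp add: sublinear_def)

lemma sublinear_zero:
  assumes "sublinear q" shows "q 0 = 0"
proof -
  have "q ((1/2::real) *\<^sub>R 0) \<le> 1/2 * q 0" "q (0 + 0) \<le> q 0 + q 0"
    using assms[unfolded sublinear_def, THEN conjunct2, rule_format, of "1/2" 0]
      sublinear_add[OF assms, of 0 0] by simp_all
  then show ?thesis by simp
qed

lemma sublinear_scale:
  assumes "sublinear q" "t \<ge> 0" shows "q (t *\<^sub>R x) = t * q x"
proof (cases "t = 0")
  case False
  then have t: "t > 0" using assms by simp
  have "q (inverse t *\<^sub>R (t *\<^sub>R x)) \<le> inverse t * q (t *\<^sub>R x)"
    using assms(1) t unfolding sublinear_def by (meson positive_imp_inverse_positive)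
  then have "t * q x \<le> q (t *\<^sub>R x)" using t by (simp add: field_simps)
  moreover have "q (t *\<^sub>R x) \<le> t * q x"
    using assms(1) t unfolding sublinear_def by blast
  ultimately show ?thesis by simp
qed (simp add: sublinear_zero[OF assms(1)])

lemma sublinear_neg:
  assumes "sublinear q" shows "- q (- x) \<le> q x"
  using sublinear_add[OF assms, of x "- x"] sublinear_zero[OF assms] by simp

text \<open>
  For a fixed direction \<open>y\<close>, the infimum over \<open>t \<ge> 0\<close> of \<open>q (x + t y) - t q(y)\<close> is again a sublinear
  function of \<open>x\<close> that lies below \<open>q\<close>. At \<open>x = -y\<close> and \<open>t = 1\<close> its value is at most \<open>- q y\<close>, so
  minimality of \<open>q\<close> forces \<open>q (-y) \<le> - q y\<close>. An odd sublinear functional is additive.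
\<close>

lemma minimal_sublinear_linear:
  assumes q: "sublinear q" and min: "\<And>r. sublinear r \<Longrightarrow> r \<le> q \<Longrightarrow> r = q"
  shows "linear q"
proof -
  have neg: "q (- y) = - q y" for y
  proof -
    define S where "S x = (\<lambda>t. q (x + t *\<^sub>R y) - t * q y) ` {0..}" for x
    define r where "r x = Inf (S x)" for x
    have low: "- q (- x) \<le> z" if z: "z \<in> S x" for x z
    proof -
      obtain t where t: "t \<ge> 0" "z = q (x + t *\<^sub>R y) - t * q y"
        using z unfolding S_def by auto
      have "q (t *\<^sub>R y) \<le> q (x + t *\<^sub>R y) + q (- x)"
        using sublinear_add[OF q, of "x + t *\<^sub>R y" "- x"] by simp
      then show ?thesis using t sublinear_scale[OF q t(1), of y] by simp
    qed
    have bdd: "bdd_below (S x)" for x using low by (meson bdd_belowI)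
    have ne: "S x \<noteq> {}" for x by (simp add: S_def)
    have le: "r x \<le> q (x + t *\<^sub>R y) - t * q y" if "t \<ge> 0" for x t
      unfolding r_def by (rule cInf_lower[OF _ bdd]) (use that S_def in auto)
    have "sublinear r" unfolding sublinear_def
    proof (intro conjI allI impI)
      fix x1 x2
      have "r (x1 + x2) - z2 \<le> z1" if z: "z1 \<in> S x1" "z2 \<in> S x2" for z1 z2
      proof -
        obtain t1 t2 where t: "t1 \<ge> 0" "z1 = q (x1 + t1 *\<^sub>R y) - t1 * q y"
            "t2 \<ge> 0" "z2 = q (x2 + t2 *\<^sub>R y) - t2 * q y"
          using z unfolding S_def by auto
        have "r (x1 + x2) \<le> q (x1 + x2 + (t1 + t2) *\<^sub>R y) - (t1 + t2) * q y"
          using le t by simp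
        also have "x1 + x2 + (t1 + t2) *\<^sub>R y = (x1 + t1 *\<^sub>R y) + (x2 + t2 *\<^sub>R y)"
          by (simp add: algebra_simps)
        finally show ?thesis
          using sublinear_add[OF q, of "x1 + t1 *\<^sub>R y" "x2 + t2 *\<^sub>R y"] t
          by (simp add: algebra_simps)
      qed
      then have "r (x1 + x2) - z2 \<le> r x1" if "z2 \<in> S x2" for z2
        unfolding r_def[of x1] using that by (intro cInf_greatest[OF ne]) auto
      then have "r (x1 + x2) - r x1 \<le> z2" if "z2 \<in> S x2" for z2
        using that by (simp add: algebra_simps)
      then have "r (x1 + x2) - r x1 \<le> r x2"
        unfolding r_def[of x2] by (intro cInf_greatest[OF ne]) auto
      then show "r (x1 + x2) \<le> r x1 + r x2" by simp
    next
      fix s :: real and x assume s: "s > 0"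
      have "r (s *\<^sub>R x) / s \<le> z" if z: "z \<in> S x" for z
      proof -
        obtain t where t: "t \<ge> 0" "z = q (x + t *\<^sub>R y) - t * q y"
          using z unfolding S_def by auto
        have "r (s *\<^sub>R x) \<le> q (s *\<^sub>R x + (s * t) *\<^sub>R y) - (s * t) * q y"
          using le t s by simp
        also have "s *\<^sub>R x + (s * t) *\<^sub>R y = s *\<^sub>R (x + t *\<^sub>R y)"
          by (simp add: algebra_simps)
        finally have "r (s *\<^sub>R x) \<le> s * z"
          using s t sublinear_scale[OF q, of s "x + t *\<^sub>R y"] by (simp add: right_diff_distrib)
        then show ?thesis using s by (simp add: field_simps)
      qed
      then have "r (s *\<^sub>R x) / s \<le> r x"
        unfolding r_def[of x] by (intro cInf_greatest[OF ne]) auto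
      then show "r (s *\<^sub>R x) \<le> s * r x" using s by (simp add: field_simps)
    qed
    moreover have "r \<le> q" using le[of 0] by (simp add: le_fun_def)
    ultimately have "r = q" by (rule min)
    then have "q (- y) \<le> - q y" using le[of 1 "- y"] sublinear_zero[OF q] by simp
    then show ?thesis using sublinear_neg[OF q, of y] by simp
  qed
  show ?thesis
  proof (rule linearI)
    fix x y
    have "q x \<le> q (x + y) + q (- y)" using sublinear_add[OF q, of "x + y" "- y"] by simp
    then show "q (x + y) = q x + q y" using sublinear_add[OF q, of x y] neg[of y] by simp
  next
    fix t :: real and x
    show "q (t *\<^sub>R x) = t *\<^sub>R q x"
      using sublinear_scale[OF q, of t x] sublinear_scale[OF q, of "- t" x] neg[of "t *\<^sub>R x"]
      by (cases "t \<ge> 0") simp_all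
  qed
qed

text \<open>
  The pointwise infimum of a chain of sublinear functionals below \<open>p\<close> is sublinear: it is finite
  because each of them lies above \<open>- p (- x)\<close>, and subadditive because any two of them can be replaced
  by the smaller one. Zorn's lemma therefore gives a minimal one, which is linear.
\<close>

lemma Hahn_Banach_sublinear:
  assumes p: "sublinear p"
  obtains f where "linear f" "\<And>x. f x \<le> p x"
proof -
  define A where "A = {q. sublinear q \<and> q \<le> p}"
  have "\<exists>m\<in>A. \<forall>a\<in>A. a \<le> m \<longrightarrow> a = m"
  proof (rule predicate_Zorn)
    show "partial_order_on A (relation_of (\<lambda>x y. y \<le> x) A)"
      unfolding partial_order_on_def preorder_on_def refl_on_def trans_def antisym_def relation_of_def
      by auto
  next
    fix C assume "C \<in> Chains (relation_of (\<lambda>x y. y \<le> x) A)"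
    then have CA: "C \<subseteq> A" and tot: "\<And>q1 q2. q1 \<in> C \<Longrightarrow> q2 \<in> C \<Longrightarrow> q1 \<le> q2 \<or> q2 \<le> q1"
      unfolding Chains_def relation_of_def by auto
    show "\<exists>u\<in>A. \<forall>a\<in>C. u \<le> a"
    proof (cases "C = {}")
      case True then show ?thesis using p A_def by auto
    next
      case ne: False
      define u where "u x = (INF q\<in>C. q x)" for x
      have sub: "sublinear q" "q x \<le> p x" if "q \<in> C" for q x
        using CA that by (auto simp: A_def le_fun_def)
      have "- p (- x) \<le> q x" if "q \<in> C" for q x
        using sublinear_neg[OF sub(1)[OF that], of x] sub(2)[OF that, of "- x"] by linarith
      then have bdd: "bdd_below ((\<lambda>q. q x) ` C)" for x by (auto intro!: bdd_belowI2)
      have le: "u x \<le> q x" if "q \<in> C" for q x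
        unfolding u_def by (rule cINF_lower[OF bdd that])
      have "sublinear u" unfolding sublinear_def
      proof (intro conjI allI impI)
        fix x y
        have "u (x + y) - q2 y \<le> q1 x" if q12: "q1 \<in> C" "q2 \<in> C" for q1 q2
        proof -
          obtain q where q: "q \<in> C" "q \<le> q1" "q \<le> q2" using tot q12 by blast
          have "u (x + y) \<le> q x + q y"
            using le[OF q(1), of "x + y"] sublinear_add[OF sub(1)[OF q(1)], of x y] by linarith
          then show ?thesis using q(2,3) le_funD[of q q1 x] le_funD[of q q2 y] by linarith
        qed
        then have "u (x + y) - q2 y \<le> u x" if "q2 \<in> C" for q2
          unfolding u_def[of x] using that by (intro cINF_greatest[OF ne]) auto
        then have "u (x + y) - u x \<le> q2 y" if "q2 \<in> C" for q2
          using that by (simp add: algebra_simps)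
        then have "u (x + y) - u x \<le> u y"
          unfolding u_def[of y] by (intro cINF_greatest[OF ne]) auto
        then show "u (x + y) \<le> u x + u y" by simp
      next
        fix t :: real and x assume t: "t > 0"
        have "u (t *\<^sub>R x) / t \<le> q x" if "q \<in> C" for q
          using le[OF that, of "t *\<^sub>R x"] sublinear_scale[OF sub(1)[OF that], of t x] t
          by (simp add: field_simps)
        then have "u (t *\<^sub>R x) / t \<le> u x"
          unfolding u_def[of x] by (intro cINF_greatest[OF ne]) auto
        then show "u (t *\<^sub>R x) \<le> t * u x" using t by (simp add: field_simps)
      qed
      moreover have "u \<le> p"
        using ne le sub(2) unfolding le_fun_def by (meson all_not_in_conv order_trans)
      ultimately show ?thesis using le unfolding A_def by (intro bexI[of _ u]) (auto simp: le_fun_def)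
    qed
  qed
  then obtain m where m: "m \<in> A" "\<And>a. a \<in> A \<Longrightarrow> a \<le> m \<Longrightarrow> a = m" by blast
  have "linear m"
  proof (rule minimal_sublinear_linear)
    show "sublinear m" using m(1) by (simp add: A_def)
    show "r = m" if "sublinear r" "r \<le> m" for r
      using that m(1) by (intro m(2)) (auto simp: A_def)
  qed
  then show ?thesis using that[of m] m(1) by (auto simp: A_def le_fun_def)
qed

section \<open>Subgradients of lower semicontinuous convex functions\<close>

lemma lower_semicontinuous_open:
  assumes "lower_semicontinuous f"
  shows "open {x. a < f x}"
  unfolding eventually_nhds_in_open open_subopen[of "{x. a < f x}"]
proof safe
  fix x assume "a < f x"
  then have "eventually (\<lambda>y. a < f y) (nhds x)"
    using assms unfolding lower_semicontinuous_def by blast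
  then show "\<exists>T. open T \<and> x \<in> T \<and> T \<subseteq> {x. a < f x}"
    unfolding eventually_nhds by blast
qed

lemma lower_semicontinuous_section:
  assumes "lower_semicontinuous (\<lambda>(u, w). j u w)"
  shows "lower_semicontinuous (\<lambda>u. j u w)"
  unfolding lower_semicontinuous_def
proof safe
  fix u a assume "a < j u w"
  then have ev: "eventually (\<lambda>z. a < (\<lambda>(u, w). j u w) z) (nhds (u, w))"
    using assms unfolding lower_semicontinuous_def by auto
  have "((\<lambda>v. (v, w)) \<longlongrightarrow> (u, w)) (nhds u)"
    by (intro tendsto_Pair tendsto_const) (rule filterlim_ident)
  from eventually_compose_filterlim[OF ev this]
  show "eventually (\<lambda>v. a < j v w) (nhds u)" by simp
qed

text \<open>
  The closed sublevel sets \<open>{x. f x \<le> n}\<close> cover the Banach space, so by Baire one of them has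
  interior points.
\<close>

lemma lower_semicontinuous_bounded_above_on_ball:
  fixes f :: "'u::banach \<Rightarrow> real"
  assumes "lower_semicontinuous f"
  obtains x0 r C where "r > 0" "\<And>x. x \<in> ball x0 r \<Longrightarrow> f x \<le> C"
proof -
  define T where "T n = {x. f x \<le> real n}" for n :: nat
  have cl: "closed (T n)" for n
    using lower_semicontinuous_open[OF assms, of "real n"]
    by (simp add: T_def closed_def Collect_neg_eq[symmetric] not_le)
  have un: "\<Union> (range T) = UNIV"
    using real_arch_simple by (fastforce simp: T_def)
  have "\<exists>n. interior (T n) \<noteq> {}"
  proof (rule ccontr)
    assume "\<nexists>n. interior (T n) \<noteq> {}"
    then have "euclidean interior_of \<Union> (range T) = {}"
      using cl by (intro Baire_category_alt disjI1 completely_metrizable_space_euclidean)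
        (auto simp: closed_closedin[symmetric])
    then show False by (simp add: un)
  qed
  then obtain n x0 where "x0 \<in> interior (T n)" by blast
  then obtain r where "r > 0" "ball x0 r \<subseteq> T n" by (auto simp: mem_interior)
  show ?thesis
  proof (rule that)
    show "r > 0" by fact
    show "f x \<le> real n" if "x \<in> ball x0 r" for x
      using that \<open>ball x0 r \<subseteq> T n\<close> unfolding T_def by blast
  qed
qed

text \<open>
  A point close to \<open>u\<close> is the midpoint of a point of the ball around \<open>x0\<close> and the reflection of
  \<open>x0\<close> in \<open>u\<close>, so convexity carries an upper bound from near \<open>x0\<close> to near \<open>u\<close>.
\<close>

lemma convex_lsc_locally_bounded_above:
  fixes f :: "'u::banach \<Rightarrow> real"
  assumes convex: "convex_on UNIV f" and lsc: "lower_semicontinuous f"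
  obtains r C where "r > 0" "\<And>h. norm h < r \<Longrightarrow> f (u + h) \<le> C"
proof -
  obtain x0 r C where r: "r > 0" and C: "\<And>x. x \<in> ball x0 r \<Longrightarrow> f x \<le> C"
    by (rule lower_semicontinuous_bounded_above_on_ball[OF lsc]) (rule that)
  define y where "y = 2 *\<^sub>R u - x0"
  have "f (u + h) \<le> C / 2 + f y / 2" if h: "norm h < r / 2" for h
  proof -
    have "u + h = (1 - 1/2) *\<^sub>R (x0 + 2 *\<^sub>R h) + (1/2) *\<^sub>R y"
      by (simp add: y_def algebra_simps)
    also have "f \<dots> \<le> (1 - 1/2) * f (x0 + 2 *\<^sub>R h) + (1/2) * f y"
      by (rule convex_onD[OF convex]) auto
    also have "f (x0 + 2 *\<^sub>R h) \<le> C" using h by (intro C) (simp add: dist_norm)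
    finally show ?thesis by simp
  qed
  then show ?thesis using that[of "r / 2" "C / 2 + f y / 2"] r by simp
qed

text \<open>
  For convex \<open>f\<close> the difference quotients are monotone in \<open>t\<close>, so their infimum is the one-sided
  derivative of \<open>f\<close> at \<open>u\<close> in direction \<open>h\<close>. The infimum form needs no limit.
\<close>

definition directional_derivative ::
  "('u::real_vector \<Rightarrow> real) \<Rightarrow> 'u \<Rightarrow> 'u \<Rightarrow> real" where
  "directional_derivative f u h = (INF t\<in>{0<..}. (f (u + t *\<^sub>R h) - f u) / t)"

text \<open>
  The point \<open>u\<close> is a convex combination of \<open>u - h\<close> and \<open>u + t h\<close>. The bound makes the infimum that
  defines the directional derivative finite.
\<close>

lemma difference_quotient_bounded_below:
  assumes convex: "convex_on UNIV f" and t: "t > 0"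
  shows "f u - f (u - h) \<le> (f (u + t *\<^sub>R h) - f u) / t"
proof -
  define l where "l = 1 / (1 + t)"
  have l: "l * t = 1 - l" "(1 + t) * l = 1" "0 \<le> l" "l \<le> 1"
    using t by (simp_all add: l_def field_simps)
  have "(1 - l) *\<^sub>R (u - h) + l *\<^sub>R (u + t *\<^sub>R h) = (1 - l) *\<^sub>R (u - h) + l *\<^sub>R u + (1 - l) *\<^sub>R h"
    by (simp add: scaleR_add_right l(1))
  also have "\<dots> = u" by (simp add: algebra_simps)
  finally have "f u \<le> (1 - l) * f (u - h) + l * f (u + t *\<^sub>R h)"
    using convex_onD[OF convex l(3,4), of "u - h" "u + t *\<^sub>R h"] by simp
  also have "\<dots> = l * (t * f (u - h) + f (u + t *\<^sub>R h))"
    unfolding l(1)[symmetric] by (simp only: distrib_left mult.assoc)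
  finally have "(1 + t) * f u \<le> (1 + t) * (l * (t * f (u - h) + f (u + t *\<^sub>R h)))"
    using t by (intro mult_left_mono) auto
  also have "\<dots> = t * f (u - h) + f (u + t *\<^sub>R h)"
    unfolding mult.assoc[symmetric] l(2) by simp
  finally show ?thesis using t by (simp add: field_simps)
qed

lemma directional_derivative_le:
  assumes "convex_on UNIV f" "t > 0"
  shows "directional_derivative f u h \<le> (f (u + t *\<^sub>R h) - f u) / t"
  unfolding directional_derivative_def
  by (rule cINF_lower)
    (use difference_quotient_bounded_below[OF assms(1)] assms(2) in \<open>auto intro!: bdd_belowI2\<close>)

lemma le_directional_derivative:
  assumes "\<And>t. t > 0 \<Longrightarrow> c \<le> (f (u + t *\<^sub>R h) - f u) / t"
  shows "c \<le> directional_derivative f u h"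
  unfolding directional_derivative_def by (rule cINF_greatest) (use assms in auto)

lemma sublinear_directional_derivative:
  assumes convex: "convex_on UNIV f"
  shows "sublinear (directional_derivative f u)"
  unfolding sublinear_def
proof (intro conjI allI impI)
  fix h k
  let ?D = "directional_derivative f u"
  let ?q = "\<lambda>h t. (f (u + t *\<^sub>R h) - f u) / t"
  have *: "?D (h + k) \<le> ?q h s + ?q k t" if st: "s > 0" "t > 0" for s t
  proof -
    \<comment> \<open>These weights place the convex combination of \<open>u + s h\<close> and \<open>u + t k\<close> on the ray through
      \<open>h + k\<close>, at parameter \<open>\<tau>\<close>.\<close>
    define l where "l = s / (s + t)"
    define \<tau> where "\<tau> = s * t / (s + t)"
    have l': "1 - l = t / (s + t)" using st by (simp add: l_def field_simps)
    have l: "0 \<le> l" "l \<le> 1" "\<tau> > 0" "1 - l = \<tau> / s" "l = \<tau> / t" "(1 - l) * s = \<tau>" "l * t = \<tau>"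
      unfolding l' using st by (simp_all add: l_def \<tau>_def)
    have "u + \<tau> *\<^sub>R (h + k) = (1 - l) *\<^sub>R u + l *\<^sub>R u + ((1 - l) * s) *\<^sub>R h + (l * t) *\<^sub>R k"
      unfolding l(6,7) by (simp add: scaleR_add_right scaleR_add_left[symmetric])
    also have "\<dots> = (1 - l) *\<^sub>R (u + s *\<^sub>R h) + l *\<^sub>R (u + t *\<^sub>R k)"
      by (simp add: scaleR_add_right)
    also have "f \<dots> \<le> (1 - l) * f (u + s *\<^sub>R h) + l * f (u + t *\<^sub>R k)"
      using l by (intro convex_onD[OF convex]) auto
    finally have "f (u + \<tau> *\<^sub>R (h + k)) - f u
        \<le> (1 - l) * (f (u + s *\<^sub>R h) - f u) + l * (f (u + t *\<^sub>R k) - f u)"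
      by (simp add: algebra_simps)
    also have "\<dots> = \<tau> * (?q h s + ?q k t)"
      unfolding l(4) by (simp add: l(5) distrib_left)
    finally have "?q (h + k) \<tau> \<le> ?q h s + ?q k t"
      using l(3) by (simp add: field_simps)
    then show ?thesis using directional_derivative_le[OF convex l(3), of u "h + k"] by linarith
  qed
  have "?D (h + k) - ?q k t \<le> ?D h" if "t > 0" for t
    using *[OF _ that] by (intro le_directional_derivative) (simp add: algebra_simps)
  then have "?D (h + k) - ?D h \<le> ?D k"
    by (intro le_directional_derivative) (simp add: algebra_simps)
  then show "?D (h + k) \<le> ?D h + ?D k" by simp
next
  fix t :: real and h assume t: "t > 0"
  have "directional_derivative f u (t *\<^sub>R h) / t \<le> directional_derivative f u h"
  proof (rule le_directional_derivative)
    fix s :: real assume s: "s > 0"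
    have "directional_derivative f u (t *\<^sub>R h) \<le> (f (u + (s / t) *\<^sub>R t *\<^sub>R h) - f u) / (s / t)"
      using s t by (intro directional_derivative_le[OF convex]) simp
    then show "directional_derivative f u (t *\<^sub>R h) / t \<le> (f (u + s *\<^sub>R h) - f u) / s"
      using s t by (simp add: field_simps)
  qed
  then show "directional_derivative f u (t *\<^sub>R h) \<le> t * directional_derivative f u h"
    using t by (simp add: field_simps)
qed

text \<open>
  A linear functional below the directional derivative satisfies the subgradient inequality. It is
  continuous because \<open>f\<close> is bounded above near \<open>u\<close>, which bounds the functional on a ball.
\<close>

lemma subdifferential_nonempty:
  fixes f :: "'u::banach \<Rightarrow> real"
  assumes convex: "convex_on UNIV f" and lsc: "lower_semicontinuous f"
  shows "subdifferential f u \<noteq> {}"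
proof -
  obtain s where s: "linear s" "\<And>h. s h \<le> directional_derivative f u h"
    by (rule Hahn_Banach_sublinear[OF sublinear_directional_derivative[OF convex, of u]]) (rule that)
  have le: "s h \<le> f (u + h) - f u" for h
    using s(2)[of h] directional_derivative_le[OF convex, of 1 u h] by simp
  obtain r C where r: "r > 0" and C: "\<And>h. norm h < r \<Longrightarrow> f (u + h) \<le> C"
    by (rule convex_lsc_locally_bounded_above[OF convex lsc, of u]) (rule that)
  define B where "B = C - f u"
  have B: "s h \<le> norm h * (2 * B / r)" for h
  proof (cases "h = 0")
    case False
    define k where "k = r / (2 * norm h)"
    have k: "k > 0" using r False by (simp add: k_def)
    have "k * s h = s (k *\<^sub>R h)" using s(1) by (simp add: linear_scale)
    also have "\<dots> \<le> f (u + k *\<^sub>R h) - f u" by (rule le)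
    also have "f (u + k *\<^sub>R h) \<le> C" using r False by (intro C) (simp add: k_def)
    finally have "s h \<le> B / k" using k by (simp add: B_def field_simps)
    then show ?thesis using r False by (simp add: k_def field_simps)
  qed (simp add: linear_0[OF s(1)])
  have "bounded_linear s"
  proof (rule bounded_linear_intro)
    show "s (x + y) = s x + s y" "s (c *\<^sub>R x) = c *\<^sub>R s x" for x y c
      using s(1) by (simp_all add: linear_add linear_scale)
    show "norm (s h) \<le> norm h * (2 * B / r)" for h
      using B[of h] B[of "- h"] by (simp add: linear_neg[OF s(1)] abs_le_iff)
  qed
  then have "blinfun_apply (Blinfun s) (v - u) \<le> f v - f u" for v
    using le[of "v - u"] by (simp add: bounded_linear_Blinfun_apply)
  then have "f u + blinfun_apply (Blinfun s) (v - u) \<le> f v" for v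
    by (simp add: le_diff_eq add.commute)
  then have "Blinfun s \<in> subdifferential f u" by (simp add: subdifferential_def)
  then show ?thesis by blast
qed

text \<open>
  The bound is one-sided: it uses a subgradient at \<open>u\<close> only, so it also applies when nothing is known
  about subgradients at \<open>v\<close>.
\<close>

lemma subgradient_bound_imp_lipschitz:
  assumes "subdifferential f u \<noteq> {}"
    and "\<And>r. r \<in> subdifferential f u \<Longrightarrow> norm r \<le> L"
  shows "f u - f v \<le> L * norm (u - v)"
proof -
  obtain r where r: "r \<in> subdifferential f u" using assms(1) by blast
  have "f u - f v \<le> blinfun_apply r (u - v)"
  proof -
    have "f u + blinfun_apply r (v - u) \<le> f v" using r by (simp add: subdifferential_def)
    then show ?thesis by (simp add: blinfun.diff_right)
  qed
  also have "\<dots> \<le> norm r * norm (u - v)"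
    using norm_blinfun[of r "u - v"] by (simp add: abs_le_iff)
  also have "\<dots> \<le> L * norm (u - v)" using assms(2)[OF r] by (intro mult_right_mono) auto
  finally show ?thesis .
qed

text \<open>
  Comparing \<open>x\<close> with \<open>x + t (u - x)\<close>, dividing by \<open>t\<close> and letting \<open>t\<close> tend to \<open>0\<close> differentiates the
  smooth part \<open>K\<close>, while the nonsmooth part \<open>s\<close> is handled by convexity.
\<close>

lemma minimizer_variational_inequality:
  assumes S: "convex S" and s: "convex_on UNIV s" and e: "e \<ge> 0"
    and grad: "has_gateaux_derivative K g x"
    and min: "is_arg_min (\<lambda>v. K v + blinfun_apply p v + e * s v) (\<lambda>v. v \<in> S) x"
    and u: "u \<in> S"
  shows "0 \<le> blinfun_apply (g + p) (u - x) + e * (s u - s x)"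
proof -
  have xS: "x \<in> S" and le: "\<And>v. v \<in> S \<Longrightarrow>
      K x + blinfun_apply p x + e * s x \<le> K v + blinfun_apply p v + e * s v"
    using min by (auto simp: is_arg_min_linorder)
  have "((\<lambda>t. (K (x + t *\<^sub>R (u - x)) - K x) / t) \<longlongrightarrow> blinfun_apply g (u - x)) (at_right 0)"
    using grad unfolding has_gateaux_derivative_def by (blast intro: tendsto_mono at_le)
  then have "- (blinfun_apply p (u - x) + e * (s u - s x)) \<le> blinfun_apply g (u - x)"
  proof (rule tendsto_lowerbound)
    show "eventually (\<lambda>t. - (blinfun_apply p (u - x) + e * (s u - s x))
      \<le> (K (x + t *\<^sub>R (u - x)) - K x) / t) (at_right 0)"
    proof -
      have "- (blinfun_apply p (u - x) + e * (s u - s x)) \<le> (K (x + t *\<^sub>R (u - x)) - K x) / t"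
        if t: "0 < t" "t < 1" for t
      proof -
        have eq: "x + t *\<^sub>R (u - x) = (1 - t) *\<^sub>R x + t *\<^sub>R u" by (simp add: algebra_simps)
        have "x + t *\<^sub>R (u - x) \<in> S"
          unfolding eq using S xS u t by (intro convexD) auto
        note le[OF this]
        moreover have "blinfun_apply p (x + t *\<^sub>R (u - x)) = blinfun_apply p x + t * blinfun_apply p (u - x)"
          by (simp only: blinfun.add_right blinfun.scaleR_right real_scaleR_def)
        moreover have "e * s (x + t *\<^sub>R (u - x)) \<le> e * ((1 - t) * s x + t * s u)"
          unfolding eq using convex_onD[OF s, of t x u] t e by (intro mult_left_mono) auto
        moreover have "e * ((1 - t) * s x + t * s u) = e * s x + t * (e * (s u - s x))"
          by (simp add: algebra_simps)
        ultimately have "- t * (blinfun_apply p (u - x) + e * (s u - s x)) \<le> K (x + t *\<^sub>R (u - x)) - K x"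
          unfolding mult_minus_left distrib_left by linarith
        then show ?thesis using t by (simp only: pos_le_divide_eq mult_minus_left mult_minus_right mult.commute)
      qed
      then show ?thesis
        unfolding eventually_at_right_field by (intro exI[of _ 1] conjI allI impI) simp_all
    qed
  qed simp
  then show ?thesis by (simp add: blinfun.add_left)
qed

section \<open>The Bregman divergence along one step\<close>

definition bregman :: "('u::real_normed_vector \<Rightarrow> real) \<Rightarrow> ('u \<Rightarrow> 'u \<Rightarrow>\<^sub>L real) \<Rightarrow> 'u \<Rightarrow> 'u \<Rightarrow> real" where
  "bregman K dK v u = K v - K u - blinfun_apply (dK u) (v - u)"

text \<open>
  The decisive inequality for one step from \<open>x\<close> to \<open>y\<close>, with reference point \<open>u\<close>. In the three-point
  identity for the Bregman divergence the optimality condition at \<open>y\<close> replaces the gradient difference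
  by \<open>g\<close>, \<open>r\<close> and \<open>s\<close>. Everything that the condition evaluates at \<open>y\<close> is moved to \<open>x\<close> at the price of
  \<open>e (Lg + Ls + q)\<close> times the step length, which the quadratic gain from strong convexity absorbs.
  Having \<open>s\<close> at \<open>x\<close> matters for the expectation: the current iterate is independent of the
  sample that defines \<open>f\<close> and \<open>s\<close>, the next iterate is not.
\<close>

lemma one_step_decrease:
  fixes K :: "'u::real_normed_vector \<Rightarrow> real"
  assumes b: "b > 0" and e: "e \<ge> 0"
    and strong: "K y \<ge> K x + blinfun_apply (dK x) (y - x) + b / 2 * (norm (x - y))\<^sup>2"
    and opt: "0 \<le> blinfun_apply (dK y - dK x + e *\<^sub>R (g + r)) (u - y) + e * (s u - s y)"
    and g: "g \<in> subdifferential f x" "norm g \<le> Lg"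
    and s: "s x - s y \<le> Ls * norm (x - y)"
    and r: "norm r \<le> q"
  shows "bregman K dK u y + e * (f x + s x - (f u + s u))
     \<le> bregman K dK u x + e * q * norm (x - u) + (e * (Lg + Ls + q))\<^sup>2 / (2 * b)"
proof -
  define z where "z = norm (x - y)"
  define L where "L = Lg + Ls + q"
  have ap: "blinfun_apply l v \<le> c * norm v" if "norm l \<le> c" for l :: "'u \<Rightarrow>\<^sub>L real" and c v
    using norm_blinfun[of l v] mult_right_mono[OF that, of "norm v"] by simp
  have 1: "bregman K dK u y - bregman K dK u x
      = - (K y - K x - blinfun_apply (dK x) (y - x)) - blinfun_apply (dK y - dK x) (u - y)"
  proof -
    have "blinfun_apply (dK x) (u - x) = blinfun_apply (dK x) (u - y) + blinfun_apply (dK x) (y - x)"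
      by (simp add: blinfun.add_right[symmetric])
    then show ?thesis by (simp add: bregman_def blinfun.diff_left)
  qed
  have "- blinfun_apply (dK y - dK x) (u - y) \<le> e * (blinfun_apply (g + r) (u - y) + s u - s y)"
  proof -
    have "blinfun_apply (dK y - dK x + e *\<^sub>R (g + r)) (u - y)
        = blinfun_apply (dK y - dK x) (u - y) + e * blinfun_apply (g + r) (u - y)"
      by (simp only: blinfun.add_left blinfun.scaleR_left real_scaleR_def)
    then show ?thesis using opt unfolding distrib_left right_diff_distrib by linarith
  qed
  also have "blinfun_apply (g + r) (u - y) + s u - s y
      \<le> f u + s u - f x - s x + q * norm (x - u) + L * z"
  proof -
    have "blinfun_apply (g + r) (u - y)
        = blinfun_apply g (u - x) + blinfun_apply r (u - x) + blinfun_apply g (x - y) + blinfun_apply r (x - y)"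
    proof -
      have "blinfun_apply l (u - y) = blinfun_apply l (u - x) + blinfun_apply l (x - y)" for l :: "'u \<Rightarrow>\<^sub>L real"
        by (simp add: blinfun.add_right[symmetric])
      from this[of g] this[of r] show ?thesis by (simp add: blinfun.add_left)
    qed
    moreover have "blinfun_apply g (u - x) \<le> f u - f x"
    proof -
      have "f x + blinfun_apply g (u - x) \<le> f u" using g(1) by (simp add: subdifferential_def)
      then show ?thesis by simp
    qed
    moreover have "blinfun_apply r (u - x) \<le> q * norm (x - u)"
      using ap[OF r, of "u - x"] by (simp add: norm_minus_commute)
    moreover have "blinfun_apply g (x - y) \<le> Lg * z" "blinfun_apply r (x - y) \<le> q * z"
      unfolding z_def using g(2) r by (auto intro: ap)
    moreover have "s x - s y \<le> Ls * z" using s by (simp add: z_def)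
    ultimately show ?thesis unfolding L_def distrib_right by linarith
  qed
  finally have 2: "- blinfun_apply (dK y - dK x) (u - y)
      \<le> e * (f u + s u - f x - s x + q * norm (x - u) + L * z)"
    using e by (meson mult_left_mono order_trans)
  have 3: "e * L * z - b / 2 * z\<^sup>2 \<le> (e * L)\<^sup>2 / (2 * b)"
  proof -
    \<comment> \<open>The maximum of the left side over \<open>z\<close> is attained at \<open>b * z = e * L\<close>.\<close>
    have "0 \<le> (b * z - e * L)\<^sup>2" by simp
    moreover have "2 * b * (e * L * z - b / 2 * z\<^sup>2) = (e * L)\<^sup>2 - (b * z - e * L)\<^sup>2"
      by (simp add: power2_eq_square algebra_simps)
    ultimately have "(e * L * z - b / 2 * z\<^sup>2) * (2 * b) \<le> (e * L)\<^sup>2"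
      by (simp add: mult.commute)
    then show ?thesis using b by (simp add: pos_le_divide_eq)
  qed
  have "bregman K dK u y - bregman K dK u x
     \<le> - (b / 2 * z\<^sup>2) + e * (f u + s u - f x - s x + q * norm (x - u) + L * z)"
    using 1 2 strong[folded z_def] by linarith
  then have "bregman K dK u y + e * (f x + s x - (f u + s u))
     \<le> bregman K dK u x + e * q * norm (x - u) + (e * L * z - b / 2 * z\<^sup>2)"
    unfolding distrib_left right_diff_distrib mult.assoc by linarith
  then show ?thesis using 3 unfolding L_def by linarith
qed

section \<open>Measurability and independence\<close>

text \<open>
  One countable base is enough: \<open>O'\<close> is the union, over basic open sets \<open>b\<close> of the first factor, of
  \<open>b\<close> times the largest open set whose product with \<open>b\<close> lies in \<open>O'\<close>. The second factor may be an
  arbitrary topological space, which is what a general sample space requires.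
\<close>

lemma open_in_product_sigma_algebra:
  fixes O' :: "('u::second_countable_topology \<times> 'w::topological_space) set"
  assumes "open O'"
  shows "O' \<in> sets (borel \<Otimes>\<^sub>M borel)"
proof -
  obtain B :: "'u set set" where "countable B \<and> topological_basis B"
    using ex_countable_basis ..
  then have B: "countable B" "topological_basis B" by auto
  define V where "V b = \<Union>{T. open T \<and> b \<times> T \<subseteq> O'}" for b :: "'u set"
  have "O' = (\<Union>b\<in>B. b \<times> V b)"
  proof (intro equalityI subsetI)
    fix z assume "z \<in> O'"
    then obtain S T where ST: "open S" "open T" "z \<in> S \<times> T" "S \<times> T \<subseteq> O'"
      by (rule open_prod_elim[OF assms])
    then obtain b where b: "b \<in> B" "fst z \<in> b" "b \<subseteq> S"
      using B(2) by (auto elim!: topological_basisE)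
    then have "b \<times> T \<subseteq> O'" using ST(4) by blast
    then have "snd z \<in> V b" using ST(2,3) by (auto simp: V_def)
    then show "z \<in> (\<Union>b\<in>B. b \<times> V b)" using b by (auto intro!: bexI[of _ b] simp: mem_Times_iff)
  next
    fix z assume "z \<in> (\<Union>b\<in>B. b \<times> V b)"
    then show "z \<in> O'" by (auto simp: V_def)
  qed
  moreover have "b \<times> V b \<in> sets (borel \<Otimes>\<^sub>M borel)" if "b \<in> B" for b
  proof -
    have "open b" using B(2) that by (rule topological_basis_open)
    moreover have "open (V b)" unfolding V_def by (rule open_Union) blast
    ultimately show ?thesis by (intro pair_measureI) auto
  qed
  ultimately show ?thesis using B(1) by (simp only:) (intro sets.countable_UN', auto)
qed

lemma lower_semicontinuous_measurable:
  assumes "lower_semicontinuous f"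
  shows "f \<in> borel_measurable borel"
  using lower_semicontinuous_open[OF assms] by (intro borel_measurableI_greater) simp

lemma lower_semicontinuous_measurable_pair:
  fixes f :: "'u::second_countable_topology \<times> 'w::topological_space \<Rightarrow> real"
  assumes "lower_semicontinuous f"
  shows "f \<in> borel_measurable (borel \<Otimes>\<^sub>M borel)"
  using open_in_product_sigma_algebra[OF lower_semicontinuous_open[OF assms]]
  by (intro borel_measurableI_greater) (simp add: space_pair_measure)

lemma sample_algebra_subalgebra:
  assumes "\<And>i. i \<ge> 1 \<Longrightarrow> X i \<in> borel_measurable M"
  shows "subalgebra M (sample_algebra M X k)"
proof -
  have gen: "(\<Union>i\<in>{1..k}. {X i -` A \<inter> space M | A. A \<in> sets borel}) \<subseteq> sets M"
    using assms by (auto intro: measurable_sets)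
  then have "(\<Union>i\<in>{1..k}. {X i -` A \<inter> space M | A. A \<in> sets borel}) \<subseteq> Pow (space M)"
    using sets.space_closed by blast
  then show ?thesis
    using gen unfolding subalgebra_def sample_algebra_def by (simp add: sets.sigma_sets_subset)
qed

text \<open>
  The first \<open>k\<close> samples and the next one are disjoint groups of independent variables, so the
  sigma-algebras that the groups generate are independent. Independence is stated on events because
  \<open>Y\<close> and \<open>X (Suc k)\<close> take values in different types.
\<close>

lemma (in prob_space) adapted_indep_of_next_sample:
  fixes X :: "nat \<Rightarrow> 'a \<Rightarrow> 'w::topological_space" and Y :: "'a \<Rightarrow> 'u::topological_space"
  assumes indep: "indep_vars (\<lambda>_. borel) X {1..}"
    and Y: "Y \<in> borel_measurable (sample_algebra M X k)"
    and A: "A \<in> sets borel" and B: "B \<in> sets borel"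
  shows "prob ((Y -` A \<inter> space M) \<inter> (X (Suc k) -` B \<inter> space M))
    = prob (Y -` A \<inter> space M) * prob (X (Suc k) -` B \<inter> space M)"
proof -
  define E where "E i = {X i -` A \<inter> space M | A. A \<in> sets borel}" for i
  have sp: "(\<Union>i\<in>{1..k}. E i) \<subseteq> Pow (space M)" by (auto simp: E_def)
  have "indep_sets (\<lambda>j. sigma_sets (space M) (\<Union>i\<in>case_bool {1..k} {Suc k} j. E i)) UNIV"
  proof (rule indep_sets_collect_sigma)
    show "indep_sets E (\<Union>j\<in>UNIV. case_bool {1..k} {Suc k} j)"
    proof (rule indep_sets_mono_index)
      show "indep_sets E {1..}" using indep unfolding indep_vars_def2 E_def by blast
    qed (auto split: bool.splits)
    show "Int_stable (E i)" for i
    proof (rule Int_stableI)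
      fix a b assume "a \<in> E i" "b \<in> E i"
      then obtain A B where "A \<in> sets borel" "B \<in> sets borel"
        "a = X i -` A \<inter> space M" "b = X i -` B \<inter> space M" unfolding E_def by blast
      then show "a \<inter> b \<in> E i" unfolding E_def by (intro CollectI exI[of _ "A \<inter> B"]) auto
    qed
    show "disjoint_family_on (case_bool {1..k} {Suc k}) UNIV"
      by (auto simp: disjoint_family_on_def split: bool.split)
  qed
  then have "indep_set (sigma_sets (space M) (\<Union>i\<in>{1..k}. E i)) (sigma_sets (space M) (E (Suc k)))"
    unfolding indep_set_def by (rule indep_sets_mono_sets) (auto split: bool.split)
  moreover have "Y -` A \<inter> space M \<in> sigma_sets (space M) (\<Union>i\<in>{1..k}. E i)"
    using measurable_sets[OF Y A] sp unfolding sample_algebra_def E_def[symmetric] by simp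
  moreover have "X (Suc k) -` B \<inter> space M \<in> sigma_sets (space M) (E (Suc k))"
    using B by (auto simp: E_def intro!: sigma_sets.Basic)
  ultimately show ?thesis by (rule indep_setD)
qed

text \<open>
  Independence says that the joint law is the product of the marginal laws, and the rest is Fubini's
  theorem. It replaces conditioning on \<open>X\<close> by freezing its value.
\<close>

lemma (in prob_space) expectation_indep_pair:
  fixes f :: "'b \<times> 'c \<Rightarrow> real"
  assumes X: "random_variable S X" and Y: "random_variable T Y"
    and indep: "\<And>A B. A \<in> sets S \<Longrightarrow> B \<in> sets T \<Longrightarrow>
      prob ((X -` A \<inter> space M) \<inter> (Y -` B \<inter> space M)) = prob (X -` A \<inter> space M) * prob (Y -` B \<inter> space M)"
    and f: "f \<in> borel_measurable (S \<Otimes>\<^sub>M T)"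
    and int: "integrable M (\<lambda>\<omega>. f (X \<omega>, Y \<omega>))"
  shows "integrable M (\<lambda>\<omega>. \<integral>y. f (X \<omega>, y) \<partial>distr M T Y)"
    and "(\<integral>\<omega>. f (X \<omega>, Y \<omega>) \<partial>M) = (\<integral>\<omega>. (\<integral>y. f (X \<omega>, y) \<partial>distr M T Y) \<partial>M)"
proof -
  note [measurable] = X Y f
  interpret PX: prob_space "distr M S X" by (rule prob_space_distr) fact
  interpret PY: prob_space "distr M T Y" by (rule prob_space_distr) fact
  interpret P: pair_prob_space "distr M S X" "distr M T Y" ..
  have D: "distr M S X \<Otimes>\<^sub>M distr M T Y = distr M (S \<Otimes>\<^sub>M T) (\<lambda>\<omega>. (X \<omega>, Y \<omega>))"
  proof (rule pair_measure_eqI)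
    fix A B assume "A \<in> sets (distr M S X)" "B \<in> sets (distr M T Y)"
    then have AB: "A \<in> sets S" "B \<in> sets T" by auto
    have "(\<lambda>\<omega>. (X \<omega>, Y \<omega>)) -` (A \<times> B) \<inter> space M = (X -` A \<inter> space M) \<inter> (Y -` B \<inter> space M)"
      by auto
    then show "emeasure (distr M S X) A * emeasure (distr M T Y) B
        = emeasure (distr M (S \<Otimes>\<^sub>M T) (\<lambda>\<omega>. (X \<omega>, Y \<omega>))) (A \<times> B)"
      using AB indep[OF AB] by (simp add: emeasure_distr emeasure_eq_measure ennreal_mult'')
  qed (simp_all add: PX.sigma_finite_measure_axioms PY.sigma_finite_measure_axioms cong: sets_pair_measure_cong)
  have i: "integrable (distr M S X \<Otimes>\<^sub>M distr M T Y) f"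
    unfolding D by (subst integrable_distr_eq) (auto intro: int)
  have m: "(\<lambda>x. \<integral>y. f (x, y) \<partial>distr M T Y) \<in> borel_measurable S"
    using borel_measurable_integrable[OF P.integrable_fst'[OF i]] by simp
  show "integrable M (\<lambda>\<omega>. \<integral>y. f (X \<omega>, y) \<partial>distr M T Y)"
    using P.integrable_fst'[OF i] m by (subst (asm) integrable_distr_eq) auto
  have "(\<integral>\<omega>. f (X \<omega>, Y \<omega>) \<partial>M) = integral\<^sup>L (distr M (S \<Otimes>\<^sub>M T) (\<lambda>\<omega>. (X \<omega>, Y \<omega>))) f"
    by (subst integral_distr) auto
  also have "\<dots> = (\<integral>x. (\<integral>y. f (x, y) \<partial>distr M T Y) \<partial>distr M S X)"
    unfolding D[symmetric] by (rule P.integral_fst'[OF i, symmetric])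
  also have "\<dots> = (\<integral>\<omega>. (\<integral>y. f (X \<omega>, y) \<partial>distr M T Y) \<partial>M)"
    by (subst integral_distr) (use m in auto)
  finally show "(\<integral>\<omega>. f (X \<omega>, Y \<omega>) \<partial>M) = (\<integral>\<omega>. (\<integral>y. f (X \<omega>, y) \<partial>distr M T Y) \<partial>M)" .
qed

section \<open>Recursive inequalities with summable perturbations\<close>

text \<open>
  The induction bounds \<open>x n\<close> and the partial sum of \<open>y\<close> together by the product of the factors
  \<open>1 + a k\<close> times the accumulated additive terms; the product stays below \<open>exp (suminf a)\<close>.
\<close>

lemma discrete_Gronwall:
  fixes x y a c :: "nat \<Rightarrow> real"
  assumes nonneg: "\<And>n. 0 \<le> x n" "\<And>n. 0 \<le> y n" "\<And>n. 0 \<le> a n" "\<And>n. 0 \<le> c n"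
    and step: "\<And>n. x (Suc n) + y n \<le> (1 + a n) * x n + c n"
    and summable: "summable a" "summable c"
  shows "(\<Sum>k<n. y k) \<le> exp (suminf a) * (x 0 + suminf c)"
proof -
  define P where "P n = (\<Prod>k<n. 1 + a k)" for n
  have P1: "P n \<ge> 1" for n unfolding P_def by (rule prod_ge_1) (use nonneg in auto)
  have "x n + (\<Sum>k<n. y k) \<le> P n * (x 0 + (\<Sum>k<n. c k))" for n
  proof (induction n)
    case (Suc n)
    have "x (Suc n) + (\<Sum>k<Suc n. y k) \<le> (1 + a n) * x n + (\<Sum>k<n. y k) + c n"
      using step[of n] by simp
    also have "\<dots> \<le> (1 + a n) * (x n + (\<Sum>k<n. y k)) + c n"
      using nonneg by (simp add: distrib_left distrib_right sum_nonneg)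
    also have "\<dots> \<le> (1 + a n) * (P n * (x 0 + (\<Sum>k<n. c k))) + P (Suc n) * c n"
      using Suc nonneg mult_right_mono[OF P1[of "Suc n"], of "c n"] by (intro add_mono mult_left_mono) auto
    also have "\<dots> = P (Suc n) * (x 0 + (\<Sum>k<Suc n. c k))"
      by (simp add: P_def algebra_simps)
    finally show ?case .
  qed (simp add: P_def)
  then have "(\<Sum>k<n. y k) \<le> P n * (x 0 + (\<Sum>k<n. c k))"
    using nonneg(1)[of n] by (smt (verit))
  also have "P n \<le> (\<Prod>k<n. exp (a k))" unfolding P_def
    by (rule prod_mono) (use nonneg in \<open>auto simp: exp_ge_add_one_self add.commute\<close>)
  also have "\<dots> = exp (\<Sum>k<n. a k)" by (simp add: exp_sum)
  also have "\<dots> \<le> exp (suminf a)" using nonneg summable by (auto intro: sum_le_suminf)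
  finally have "(\<Sum>k<n. y k) \<le> exp (suminf a) * (x 0 + (\<Sum>k<n. c k))"
    using nonneg by (simp add: mult_right_mono sum_nonneg)
  also have "\<dots> \<le> exp (suminf a) * (x 0 + suminf c)"
    using nonneg summable by (intro mult_left_mono add_left_mono sum_le_suminf) auto
  finally show ?thesis .
qed

lemma summable_power2_of_nonneg:
  fixes f :: "nat \<Rightarrow> real"
  assumes "summable f" "\<And>n. 0 \<le> f n"
  shows "summable (\<lambda>n. (f n)\<^sup>2)"
proof (rule summable_comparison_test_ev[OF _ assms(1)])
  have "f \<longlonglongrightarrow> 0" using assms(1) by (rule summable_LIMSEQ_zero)
  then have "eventually (\<lambda>n. f n < 1) sequentially" by (rule order_tendstoD) simp
  then show "eventually (\<lambda>n. norm ((f n)\<^sup>2) \<le> f n) sequentially"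
  proof eventually_elim
    case (elim n)
    then show ?case using assms(2)[of n] mult_left_mono[of "f n" 1 "f n"] by (simp add: power2_eq_square)
  qed
qed

text \<open>
  All error terms of a step grow at most like \<open>t\<^sup>2\<close>, where \<open>t\<close> is the distance to the reference point, and
  \<open>t\<^sup>2\<close> is at most \<open>2 / b * V\<close>. Hence they split into a multiplicative and an additive perturbation
  of \<open>V\<close>, and the coefficients involve only \<open>e * q\<close>, its square and \<open>e\<^sup>2\<close>, which are summable along the
  algorithm.
\<close>

lemma absorb_into_energy:
  fixes V :: real
  assumes b: "b > 0" and nonneg: "0 \<le> e" "0 \<le> q" "0 \<le> L" "0 \<le> t"
    and V: "b / 2 * t\<^sup>2 \<le> V" and L: "L \<le> A * t + B"
  shows "V + e * q * t + (e * (L + q))\<^sup>2 / (2 * b)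
     \<le> (1 + 2 / b * (e * q + 3 * A\<^sup>2 * e\<^sup>2 / (2 * b))) * V
       + (e * q + (3 * B\<^sup>2 * e\<^sup>2 + 3 * (e * q)\<^sup>2) / (2 * b))"
proof -
  have t2: "t\<^sup>2 \<le> 2 / b * V" using V b by (simp add: field_simps)
  have "2 * t \<le> 1 + t\<^sup>2" using sum_power2_ge_zero[of "t - 1" 0] by (simp add: power2_diff)
  then have t1: "t \<le> 1 + t\<^sup>2" using nonneg(4) by simp
  have "(e * (L + q))\<^sup>2 \<le> (e * (A * t + B + q))\<^sup>2"
    using nonneg L by (intro power_mono mult_left_mono) auto
  also have "\<dots> = (e * A * t + e * B + e * q)\<^sup>2" by (simp add: algebra_simps)
  also have "\<dots> \<le> 3 * (e * A * t)\<^sup>2 + 3 * (e * B)\<^sup>2 + 3 * (e * q)\<^sup>2"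
  proof -
    have *: "(x + y + z)\<^sup>2 \<le> 3 * x\<^sup>2 + 3 * y\<^sup>2 + 3 * z\<^sup>2" for x y z :: real
    proof -
      have "0 \<le> (x - y)\<^sup>2 + (x - z)\<^sup>2 + (y - z)\<^sup>2" by simp
      then show ?thesis by (simp add: power2_eq_square algebra_simps)
    qed
    show ?thesis by (rule *)
  qed
  also have "\<dots> = 3 * A\<^sup>2 * e\<^sup>2 * t\<^sup>2 + (3 * B\<^sup>2 * e\<^sup>2 + 3 * (e * q)\<^sup>2)"
    by (simp add: power_mult_distrib)
  finally have "(e * (L + q))\<^sup>2 / (2 * b)
      \<le> (3 * A\<^sup>2 * e\<^sup>2 * t\<^sup>2 + (3 * B\<^sup>2 * e\<^sup>2 + 3 * (e * q)\<^sup>2)) / (2 * b)"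
    using b by (intro divide_right_mono) auto
  also have "\<dots> = 3 * A\<^sup>2 * e\<^sup>2 / (2 * b) * t\<^sup>2 + (3 * B\<^sup>2 * e\<^sup>2 + 3 * (e * q)\<^sup>2) / (2 * b)"
    by (simp add: add_divide_distrib)
  finally have 1: "(e * (L + q))\<^sup>2 / (2 * b) \<le>
      3 * A\<^sup>2 * e\<^sup>2 / (2 * b) * t\<^sup>2 + (3 * B\<^sup>2 * e\<^sup>2 + 3 * (e * q)\<^sup>2) / (2 * b)" .
  have 2: "e * q * t \<le> e * q + e * q * t\<^sup>2"
    using mult_left_mono[OF t1, of "e * q"] nonneg by (simp add: distrib_left)
  have "(e * q + 3 * A\<^sup>2 * e\<^sup>2 / (2 * b)) * t\<^sup>2 \<le> (e * q + 3 * A\<^sup>2 * e\<^sup>2 / (2 * b)) * (2 / b * V)"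
    using t2 nonneg b by (intro mult_left_mono) auto
  also have "\<dots> = 2 / b * (e * q + 3 * A\<^sup>2 * e\<^sup>2 / (2 * b)) * V" by simp
  finally have "V + e * q * t\<^sup>2 + 3 * A\<^sup>2 * e\<^sup>2 / (2 * b) * t\<^sup>2
      \<le> (1 + 2 / b * (e * q + 3 * A\<^sup>2 * e\<^sup>2 / (2 * b))) * V"
    unfolding distrib_right by simp
  then show ?thesis using 1 2 by linarith
qed

lemma sum_powr_lower_bound:
  assumes "c > 0" "\<theta> \<ge> 0" "n \<ge> 1" and eq: "\<And>k. k \<ge> 1 \<Longrightarrow> \<epsilon> k = c * real k powr (- \<theta>)"
  shows "c * real n powr (1 - \<theta>) \<le> (\<Sum>k=1..n. \<epsilon> k)"
proof -
  have "real n powr (1 - \<theta>) = real n * real n powr (- \<theta>)"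
    using assms(3) powr_add[of "real n" 1 "- \<theta>"] by simp
  then have "c * real n powr (1 - \<theta>) = (\<Sum>k=1..n. c * real n powr (- \<theta>))" by simp
  also have "\<dots> \<le> (\<Sum>k=1..n. \<epsilon> k)"
    using assms by (intro sum_mono) (auto intro!: mult_left_mono powr_mono2')
  finally show ?thesis .
qed

section \<open>Expected costs\<close>

text \<open>
  Quadratic growth is what lets square-integrability of the iterates give integrability of the costs.
\<close>

lemma linear_growth_lipschitz_quadratic_bound:
  fixes f :: "'u::real_normed_vector \<Rightarrow> real"
  assumes lip: "\<And>u v. u \<in> S \<Longrightarrow> v \<in> S \<Longrightarrow> f u - f v \<le> (A * norm u + B) * norm (u - v)"
    and AB: "0 \<le> A" "0 \<le> B" and u: "u \<in> S" and v: "v \<in> S"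
  shows "\<bar>f u - f v\<bar> \<le> (A + B) * (2 * (norm u)\<^sup>2 + 2 * (norm v)\<^sup>2) + B"
proof -
  define n where "n = norm u + norm v"
  have n: "norm (u - v) \<le> n" "norm u \<le> n" "norm v \<le> n" "0 \<le> n"
    using norm_triangle_ineq4[of u v] by (auto simp: n_def)
  have le: "(A * norm w + B) * norm (u - v) \<le> (A * n + B) * n" if "norm w \<le> n" for w :: 'u
    using n that AB by (intro mult_mono add_mono mult_left_mono) auto
  have n2: "n\<^sup>2 \<le> 2 * (norm u)\<^sup>2 + 2 * (norm v)\<^sup>2"
    using sum_power2_ge_zero[of "norm u - norm v" 0]
    by (simp add: n_def power2_sum power2_diff)
  have "2 * n \<le> 1 + n\<^sup>2" using sum_power2_ge_zero[of "n - 1" 0] by (simp add: power2_diff)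
  then have "n \<le> 1 + n\<^sup>2" using n by simp
  then have "B * n \<le> B * (1 + n\<^sup>2)" using AB by (intro mult_left_mono) auto
  then have "(A * n + B) * n \<le> (A + B) * n\<^sup>2 + B"
    by (simp add: power2_eq_square algebra_simps)
  also have "(A + B) * n\<^sup>2 \<le> (A + B) * (2 * (norm u)\<^sup>2 + 2 * (norm v)\<^sup>2)"
    using n2 AB by (intro mult_left_mono) auto
  finally have "(A * n + B) * n \<le> (A + B) * (2 * (norm u)\<^sup>2 + 2 * (norm v)\<^sup>2) + B" by simp
  moreover have "f u - f v \<le> (A * n + B) * n"
    using lip[OF u v] le[OF n(2)] by linarith
  moreover have "f v - f u \<le> (A * n + B) * n"
    using lip[OF v u] le[OF n(3)] by (simp add: norm_minus_commute)
  ultimately show ?thesis by linarith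
qed

lemma linear_growth_lipschitz_continuous_on:
  fixes f :: "'u::real_normed_vector \<Rightarrow> real"
  assumes lip: "\<And>u v. u \<in> S \<Longrightarrow> v \<in> S \<Longrightarrow> f u - f v \<le> (A * norm u + B) * norm (u - v)"
  shows "continuous_on S f"
  unfolding continuous_on_def
proof
  fix v assume v: "v \<in> S"
  define g where "g u = (\<bar>A * norm u + B\<bar> + \<bar>A * norm v + B\<bar>) * norm (u - v)" for u
  have "(g \<longlongrightarrow> (\<bar>A * norm v + B\<bar> + \<bar>A * norm v + B\<bar>) * norm (v - v)) (at v within S)"
    unfolding g_def by (intro tendsto_intros)
  then have "(g \<longlongrightarrow> 0) (at v within S)" by simp
  moreover have "norm (f u - f v) \<le> g u" if u: "u \<in> S" for u
  proof -
    have "(A * norm u + B) * norm (u - v) \<le> g u" "(A * norm v + B) * norm (u - v) \<le> g u"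
      unfolding g_def by (intro mult_right_mono; simp)+
    then show ?thesis using lip[OF u v] lip[OF v u] by (simp add: norm_minus_commute abs_le_iff)
  qed
  then have "eventually (\<lambda>u. norm (f u - f v) \<le> g u) (at v within S)"
    by (auto simp: eventually_at_filter)
  ultimately have "((\<lambda>u. f u - f v) \<longlongrightarrow> 0) (at v within S)"
    by (rule Lim_null_comparison[rotated])
  then show "(f \<longlongrightarrow> f v) (at v within S)" by (simp add: LIM_zero_iff)
qed

lemma (in prob_space) expected_cost_lipschitz:
  assumes int: "\<And>u. u \<in> S \<Longrightarrow> integrable M (\<lambda>\<omega>. j u (W \<omega>))"
    and lip: "\<And>u v w. u \<in> S \<Longrightarrow> v \<in> S \<Longrightarrow> j u w - j v w \<le> (A * norm u + B) * norm (u - v)"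
    and "u \<in> S" "v \<in> S"
  shows "expected_cost M W j u - expected_cost M W j v \<le> (A * norm u + B) * norm (u - v)"
proof -
  have "expected_cost M W j u - expected_cost M W j v = (\<integral>\<omega>. (j u (W \<omega>) - j v (W \<omega>)) \<partial>M)"
    using assms by (simp add: expected_cost_def)
  also have "\<dots> \<le> (\<integral>\<omega>. (A * norm u + B) * norm (u - v) \<partial>M)"
    using assms by (intro integral_mono) auto
  finally show ?thesis by (simp add: prob_space)
qed

lemma convex_on_expected_cost:
  assumes S: "convex S" and int: "\<And>u. u \<in> S \<Longrightarrow> integrable M (\<lambda>\<omega>. j u (W \<omega>))"
    and convex: "\<And>w. convex_on S (\<lambda>u. j u w)"
  shows "convex_on S (expected_cost M W j)"
proof (rule convex_onI[OF _ S])
  fix t :: real and x y assume t: "0 < t" "t < 1" and xy: "x \<in> S" "y \<in> S"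
  have z: "(1 - t) *\<^sub>R x + t *\<^sub>R y \<in> S" using S xy t by (intro convexD) auto
  have "expected_cost M W j ((1 - t) *\<^sub>R x + t *\<^sub>R y)
      \<le> (\<integral>\<omega>. ((1 - t) * j x (W \<omega>) + t * j y (W \<omega>)) \<partial>M)"
    unfolding expected_cost_def using int[OF z] int[OF xy(1)] int[OF xy(2)] t xy
    by (intro integral_mono convex_onD[OF convex]) auto
  also have "\<dots> = (1 - t) * expected_cost M W j x + t * expected_cost M W j y"
    using int[OF xy(1)] int[OF xy(2)] by (simp add: expected_cost_def)
  finally show "expected_cost M W j ((1 - t) *\<^sub>R x + t *\<^sub>R y)
      \<le> (1 - t) * expected_cost M W j x + t * expected_cost M W j y" .
qed

text \<open>
  The gap on a fresh sample has the same mean as the gap of the expected cost. Differences of \<open>j\<close> are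
  used throughout: they are controlled by the growth condition, whereas \<open>j (X \<omega>) (Y \<omega>)\<close> alone
  has no uniform bound in the sample.
\<close>

lemma (in prob_space) expectation_fresh_sample_gap:
  fixes j :: "'u::{second_countable_topology, real_normed_vector} \<Rightarrow> 'w::topological_space \<Rightarrow> real"
  assumes X: "X \<in> borel_measurable M" and Y: "Y \<in> borel_measurable M" and W: "W \<in> borel_measurable M"
    and indep: "\<And>C D. C \<in> sets borel \<Longrightarrow> D \<in> sets borel \<Longrightarrow>
      prob ((X -` C \<inter> space M) \<inter> (Y -` D \<inter> space M)) = prob (X -` C \<inter> space M) * prob (Y -` D \<inter> space M)"
    and distr: "distr M borel Y = distr M borel W"
    and j: "(\<lambda>(u, w). j u w) \<in> borel_measurable (borel \<Otimes>\<^sub>M borel)"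
    and int: "\<And>u. u \<in> S \<Longrightarrow> integrable M (\<lambda>\<omega>. j u (W \<omega>))"
    and lip: "\<And>u v w. u \<in> S \<Longrightarrow> v \<in> S \<Longrightarrow> j u w - j v w \<le> (A * norm u + B) * norm (u - v)"
    and AB: "0 \<le> A" "0 \<le> B"
    and XS: "\<And>\<omega>. \<omega> \<in> space M \<Longrightarrow> X \<omega> \<in> S" and v: "v \<in> S"
    and X2: "integrable M (\<lambda>\<omega>. (norm (X \<omega>))\<^sup>2)"
  shows "integrable M (\<lambda>\<omega>. j (X \<omega>) (Y \<omega>) - j v (Y \<omega>))"
    and "integrable M (\<lambda>\<omega>. expected_cost M W j (X \<omega>) - expected_cost M W j v)"
    and "(\<integral>\<omega>. (j (X \<omega>) (Y \<omega>) - j v (Y \<omega>)) \<partial>M)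
       = (\<integral>\<omega>. (expected_cost M W j (X \<omega>) - expected_cost M W j v) \<partial>M)"
proof -
  define f where "f = (\<lambda>(u, w). j u w - j v w)"
  have f: "f \<in> borel_measurable (borel \<Otimes>\<^sub>M borel)"
  proof -
    have "(\<lambda>z. (\<lambda>(u, w). j u w) (v, snd z)) \<in> borel_measurable (borel \<Otimes>\<^sub>M borel)"
      by (rule measurable_compose[OF _ j]) measurable
    then have "(\<lambda>z. (\<lambda>(u, w). j u w) z - (\<lambda>(u, w). j u w) (v, snd z)) \<in> borel_measurable (borel \<Otimes>\<^sub>M borel)"
      using j by (rule borel_measurable_diff[rotated])
    then show ?thesis by (simp add: f_def case_prod_beta')
  qed
  show fint: "integrable M (\<lambda>\<omega>. j (X \<omega>) (Y \<omega>) - j v (Y \<omega>))"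
  proof (rule Bochner_Integration.integrable_bound)
    show "integrable M (\<lambda>\<omega>. (A + B) * (2 * (norm (X \<omega>))\<^sup>2 + 2 * (norm v)\<^sup>2) + B)"
      using X2 by simp
    have "(\<lambda>\<omega>. f (X \<omega>, Y \<omega>)) \<in> borel_measurable M"
      by (rule measurable_compose[OF measurable_Pair[OF X Y] f])
    then show "(\<lambda>\<omega>. j (X \<omega>) (Y \<omega>) - j v (Y \<omega>)) \<in> borel_measurable M" by (simp add: f_def)
    show "AE \<omega> in M. norm (j (X \<omega>) (Y \<omega>) - j v (Y \<omega>))
        \<le> norm ((A + B) * (2 * (norm (X \<omega>))\<^sup>2 + 2 * (norm v)\<^sup>2) + B)"
    proof (rule AE_I2)
      fix \<omega> assume "\<omega> \<in> space M"
      then have "\<bar>j (X \<omega>) (Y \<omega>) - j v (Y \<omega>)\<bar> \<le> (A + B) * (2 * (norm (X \<omega>))\<^sup>2 + 2 * (norm v)\<^sup>2) + B"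
        by (intro linear_growth_lipschitz_quadratic_bound[where S = S and f = "\<lambda>u. j u (Y \<omega>)"] lip AB XS v)
      also have "\<dots> \<le> norm \<dots>" unfolding real_norm_def by (rule abs_ge_self)
      finally show "norm (j (X \<omega>) (Y \<omega>) - j v (Y \<omega>))
          \<le> norm ((A + B) * (2 * (norm (X \<omega>))\<^sup>2 + 2 * (norm v)\<^sup>2) + B)"
        by (simp only: real_norm_def)
    qed
  qed
  have inner: "(\<integral>y. f (X \<omega>, y) \<partial>distr M borel Y) = expected_cost M W j (X \<omega>) - expected_cost M W j v"
    if \<omega>: "\<omega> \<in> space M" for \<omega>
  proof -
    have "(\<lambda>y. f (X \<omega>, y)) \<in> borel_measurable borel"
      by (rule measurable_compose[OF _ f]) measurable
    then have "(\<integral>y. f (X \<omega>, y) \<partial>distr M borel Y) = (\<integral>\<omega>'. f (X \<omega>, W \<omega>') \<partial>M)"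
      unfolding distr using W by (intro integral_distr)
    then show ?thesis
      using int[OF XS[OF \<omega>]] int[OF v] by (simp add: f_def expected_cost_def)
  qed
  have fint': "integrable M (\<lambda>\<omega>. f (X \<omega>, Y \<omega>))" using fint by (simp add: f_def)
  note pair = expectation_indep_pair[OF X Y indep f fint']
  show "integrable M (\<lambda>\<omega>. expected_cost M W j (X \<omega>) - expected_cost M W j v)"
    by (rule iffD1[OF Bochner_Integration.integrable_cong[OF refl inner] pair(1)])
  have "(\<integral>\<omega>. f (X \<omega>, Y \<omega>) \<partial>M)
       = (\<integral>\<omega>. (expected_cost M W j (X \<omega>) - expected_cost M W j v) \<partial>M)"
    by (rule trans[OF pair(2) Bochner_Integration.integral_cong[OF refl inner]])
  then show "(\<integral>\<omega>. (j (X \<omega>) (Y \<omega>) - j v (Y \<omega>)) \<partial>M)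
       = (\<integral>\<omega>. (expected_cost M W j (X \<omega>) - expected_cost M W j v) \<partial>M)"
    by (simp add: f_def)
qed

section \<open>The energy recursion in expectation\<close>

text \<open>
  Integrability of the energy has to be carried along the recursion, since \<open>D n\<close> is known to be
  integrable only once \<open>V n\<close> is. The sign condition on \<open>D n\<close> concerns its mean only: on a single
  sample the gap may well be negative.
\<close>

lemma (in prob_space) expected_energy_recursion:
  fixes V D :: "nat \<Rightarrow> 'a \<Rightarrow> real"
  assumes V_meas: "\<And>n. V n \<in> borel_measurable M" and V_0: "integrable M (V 0)"
    and V_nonneg: "\<And>n \<omega>. \<omega> \<in> space M \<Longrightarrow> 0 \<le> V n \<omega>"
    and D_int: "\<And>n. integrable M (V n) \<Longrightarrow> integrable M (D n)"
    and D_nonneg: "\<And>n. integrable M (V n) \<Longrightarrow> 0 \<le> (\<integral>\<omega>. D n \<omega> \<partial>M)"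
    and step: "\<And>n. AE \<omega> in M. V (Suc n) \<omega> + e n * D n \<omega> \<le> (1 + a n) * V n \<omega> + c n"
    and nonneg: "\<And>n. 0 \<le> e n" "\<And>n. 0 \<le> a n" "\<And>n. 0 \<le> c n"
    and summable: "summable a" "summable c"
  shows "integrable M (V n)"
    and "(\<Sum>k<n. e k * (\<integral>\<omega>. D k \<omega> \<partial>M)) \<le> exp (suminf a) * ((\<integral>\<omega>. V 0 \<omega> \<partial>M) + suminf c)"
proof -
  have V_int: "integrable M (V n)" for n
  proof (induction n)
    case (Suc n)
    have i: "integrable M (\<lambda>\<omega>. (1 + a n) * V n \<omega> + c n - e n * D n \<omega>)"
      using Suc D_int[OF Suc] by simp
    show ?case
    proof (rule Bochner_Integration.integrable_bound[OF i V_meas])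
      show "AE \<omega> in M. norm (V (Suc n) \<omega>) \<le> norm ((1 + a n) * V n \<omega> + c n - e n * D n \<omega>)"
        using step[of n] AE_space
      proof eventually_elim
        case (elim \<omega>)
        then show ?case using V_nonneg[of \<omega> "Suc n"] by simp
      qed
    qed
  qed (rule V_0)
  show "integrable M (V n)" by (rule V_int)
  show "(\<Sum>k<n. e k * (\<integral>\<omega>. D k \<omega> \<partial>M)) \<le> exp (suminf a) * ((\<integral>\<omega>. V 0 \<omega> \<partial>M) + suminf c)"
  proof (rule discrete_Gronwall[OF _ _ nonneg(2,3) _ summable])
    fix k
    show "0 \<le> (\<integral>\<omega>. V k \<omega> \<partial>M)" using V_nonneg by (intro integral_nonneg_AE AE_I2)
    show "0 \<le> e k * (\<integral>\<omega>. D k \<omega> \<partial>M)" using nonneg(1) D_nonneg[OF V_int] by simp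
    have "(\<integral>\<omega>. V (Suc k) \<omega> + e k * D k \<omega> \<partial>M) \<le> (\<integral>\<omega>. (1 + a k) * V k \<omega> + c k \<partial>M)"
      using V_int D_int[OF V_int] by (intro integral_mono_AE step) auto
    then show "(\<integral>\<omega>. V (Suc k) \<omega> \<partial>M) + e k * (\<integral>\<omega>. D k \<omega> \<partial>M) \<le> (1 + a k) * (\<integral>\<omega>. V k \<omega> \<partial>M) + c k"
      using V_int D_int[OF V_int] by (simp add: prob_space)
  qed
qed

section \<open>Averaged iterates\<close>

lemma averaged_iterate_weights:
  fixes \<epsilon> :: "nat \<Rightarrow> real"
  assumes "\<And>k. \<epsilon> k > 0" "i \<le> n"
  shows "(\<Sum>l=i..n. \<epsilon> l) > 0" "(\<Sum>k=i..n. \<epsilon> k / (\<Sum>l=i..n. \<epsilon> l)) = 1"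
    "\<epsilon> k / (\<Sum>l=i..n. \<epsilon> l) \<ge> 0"
proof -
  show pos: "(\<Sum>l=i..n. \<epsilon> l) > 0" using assms by (intro sum_pos) auto
  then show "(\<Sum>k=i..n. \<epsilon> k / (\<Sum>l=i..n. \<epsilon> l)) = 1" "\<epsilon> k / (\<Sum>l=i..n. \<epsilon> l) \<ge> 0"
    using assms(1)[of k] by (simp_all add: sum_divide_distrib[symmetric])
qed

lemma averaged_iterate_in_convex:
  assumes "\<And>k. \<epsilon> k > 0" "i \<le> n" "convex S" "\<And>k. U k \<omega> \<in> S"
  shows "averaged_iterate \<epsilon> U i n \<omega> \<in> S"
  unfolding averaged_iterate_def
  using averaged_iterate_weights[OF assms(1,2)] assms(3,4) by (intro convex_sum) auto

lemma convex_on_averaged_iterate_gap: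
  assumes eps: "\<And>k. \<epsilon> k > 0" "i \<le> n" and f: "convex_on S f" and U: "\<And>k. U k \<omega> \<in> S"
  shows "f (averaged_iterate \<epsilon> U i n \<omega>) - m
     \<le> (\<Sum>k=i..n. \<epsilon> k * (f (U k \<omega>) - m)) / (\<Sum>l=i..n. \<epsilon> l)"
proof -
  note w = averaged_iterate_weights[OF eps]
  have "f (averaged_iterate \<epsilon> U i n \<omega>) \<le> (\<Sum>k=i..n. \<epsilon> k / (\<Sum>l=i..n. \<epsilon> l) * f (U k \<omega>))"
    unfolding averaged_iterate_def
    using w eps U by (intro convex_on_sum[OF _ _ f]) auto
  moreover have "m = (\<Sum>k=i..n. \<epsilon> k / (\<Sum>l=i..n. \<epsilon> l) * m)"
    by (simp only: sum_distrib_right[symmetric] w(2) mult_1)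
  ultimately have "f (averaged_iterate \<epsilon> U i n \<omega>) - m
      \<le> (\<Sum>k=i..n. \<epsilon> k / (\<Sum>l=i..n. \<epsilon> l) * f (U k \<omega>)) - (\<Sum>k=i..n. \<epsilon> k / (\<Sum>l=i..n. \<epsilon> l) * m)"
    by linarith
  also have "\<dots> = (\<Sum>k=i..n. \<epsilon> k * (f (U k \<omega>) - m)) / (\<Sum>l=i..n. \<epsilon> l)"
    by (simp add: sum_divide_distrib sum_subtractf[symmetric] right_diff_distrib diff_divide_distrib)
  finally show ?thesis .
qed

lemma (in prob_space) averaged_iterate_expected_gap:
  fixes U :: "nat \<Rightarrow> 'a \<Rightarrow> 'u::{banach, second_countable_topology}"
  assumes eps: "\<And>k. \<epsilon> k > 0" "i \<le> n"
    and S: "convex S" and f: "convex_on S f" "continuous_on S f"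
    and U_meas: "\<And>k. U k \<in> borel_measurable M"
    and U: "\<And>k \<omega>. \<omega> \<in> space M \<Longrightarrow> U k \<omega> \<in> S"
    and min: "\<And>u. u \<in> S \<Longrightarrow> m \<le> f u"
    and int: "\<And>k. integrable M (\<lambda>\<omega>. f (U k \<omega>) - m)"
  shows "integrable M (\<lambda>\<omega>. f (averaged_iterate \<epsilon> U i n \<omega>) - m)"
    and "0 \<le> (\<integral>\<omega>. (f (averaged_iterate \<epsilon> U i n \<omega>) - m) \<partial>M)"
    and "(\<integral>\<omega>. (f (averaged_iterate \<epsilon> U i n \<omega>) - m) \<partial>M)
       \<le> (\<Sum>k=i..n. \<epsilon> k * (\<integral>\<omega>. (f (U k \<omega>) - m) \<partial>M)) / (\<Sum>l=i..n. \<epsilon> l)"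
proof -
  let ?a = "averaged_iterate \<epsilon> U i n"
  let ?b = "\<lambda>\<omega>. (\<Sum>k=i..n. \<epsilon> k * (f (U k \<omega>) - m)) / (\<Sum>l=i..n. \<epsilon> l)"
  have aS: "?a \<omega> \<in> S" if "\<omega> \<in> space M" for \<omega>
    using eps S U[OF that] by (rule averaged_iterate_in_convex)
  have gap: "f (?a \<omega>) - m \<le> ?b \<omega>" if "\<omega> \<in> space M" for \<omega>
    using eps f(1) U[OF that] by (rule convex_on_averaged_iterate_gap)
  have bint: "integrable M ?b" using int by simp
  have "?a \<in> borel_measurable M"
    unfolding averaged_iterate_def using U_meas by measurable
  then have "?a \<in> measurable M (restrict_space borel S)"
    using aS by (intro measurable_restrict_space2) auto
  from measurable_compose[OF this borel_measurable_continuous_on_restrict[OF f(2)]]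
  have m: "(\<lambda>\<omega>. f (?a \<omega>) - m) \<in> borel_measurable M" by simp
  show aint: "integrable M (\<lambda>\<omega>. f (?a \<omega>) - m)"
  proof (rule Bochner_Integration.integrable_bound[OF bint m AE_I2])
    fix \<omega> assume \<omega>: "\<omega> \<in> space M"
    have "norm (f (?a \<omega>) - m) = f (?a \<omega>) - m" using min[OF aS[OF \<omega>]] by simp
    also have "\<dots> \<le> norm (?b \<omega>)" using gap[OF \<omega>] abs_ge_self[of "?b \<omega>"] by (simp only: real_norm_def)
    finally show "norm (f (?a \<omega>) - m) \<le> norm (?b \<omega>)" .
  qed
  show "0 \<le> (\<integral>\<omega>. (f (?a \<omega>) - m) \<partial>M)"
    using min aS by (intro integral_nonneg_AE AE_I2) simp
  have "(\<integral>\<omega>. (f (?a \<omega>) - m) \<partial>M) \<le> (\<integral>\<omega>. ?b \<omega> \<partial>M)"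
    using gap by (intro integral_mono aint bint)
  also have "\<dots> = (\<Sum>k=i..n. \<epsilon> k * (\<integral>\<omega>. (f (U k \<omega>) - m) \<partial>M)) / (\<Sum>l=i..n. \<epsilon> l)"
    using int by simp
  finally show "(\<integral>\<omega>. (f (?a \<omega>) - m) \<partial>M)
       \<le> (\<Sum>k=i..n. \<epsilon> k * (\<integral>\<omega>. (f (U k \<omega>) - m) \<partial>M)) / (\<Sum>l=i..n. \<epsilon> l)" .
qed

section \<open>Rate of convergence of the averaged iterates\<close>

theorem theorem4p5:
  fixes M :: "'a measure"
    and Uad :: "'u::{banach, second_countable_topology} set"
    and jC jS :: "'u \<Rightarrow> 'w::real_topological_vector_space \<Rightarrow> real"
    and K :: "'u \<Rightarrow> real" and dK :: "'u \<Rightarrow> 'u \<Rightarrow>\<^sub>L real"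
    and W :: "'a \<Rightarrow> 'w" and Wk :: "nat \<Rightarrow> 'a \<Rightarrow> 'w" and F :: "nat \<Rightarrow> 'a measure"
    and JC JS J :: "'u \<Rightarrow> real"
    and \<epsilon> :: "nat \<Rightarrow> real" and R G :: "nat \<Rightarrow> 'a \<Rightarrow> 'u \<Rightarrow>\<^sub>L real"
    and u0 :: 'u and U :: "nat \<Rightarrow> 'a \<Rightarrow> 'u" and u_sharp :: 'u
    and b L_K c \<theta> c1 c2 d1 d2 :: real
  assumes reflexive: "reflexive_space TYPE('u)"
    and prob: "prob_space M" and complete: "complete_measure M"
    and Uad: "Uad \<noteq> {}" "closed Uad" "convex Uad"
    and jC_lsc: "lower_semicontinuous (\<lambda>(u, w). jC u w)"
    and jS_lsc: "lower_semicontinuous (\<lambda>(u, w). jS u w)"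
    and jC_convex: "\<And>w. convex_on UNIV (\<lambda>u. jC u w)"
    and jS_convex: "\<And>w. convex_on UNIV (\<lambda>u. jS u w)"
    and jC_subdiff: "\<And>w. \<exists>V. open V \<and> Uad \<subseteq> V \<and>
                           (\<forall>u\<in>V. subdifferential (\<lambda>v. jC v w) u \<noteq> {})"
    and K_convex: "convex_on UNIV K" and K_lsc: "lower_semicontinuous K"
    and K_gateaux: "\<And>u. has_gateaux_derivative K (dK u) u"
    and W_rv: "W \<in> borel_measurable M"
    and jC_integrable: "\<And>u. u \<in> Uad \<Longrightarrow> integrable M (\<lambda>\<omega>. jC u (W \<omega>))"
    and jS_integrable: "\<And>u. u \<in> Uad \<Longrightarrow> integrable M (\<lambda>\<omega>. jS u (W \<omega>))"
    and JC_def: "JC = expected_cost M W jC"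
    and JS_def: "JS = expected_cost M W jS"
    and J_def: "J = (\<lambda>u. JC u + JS u)"
    \<comment> \<open>the algorithm\<close>
    and Wk_indep: "prob_space.indep_vars M (\<lambda>_. borel) Wk {1..}"
    and Wk_distr: "\<And>k. k \<ge> 1 \<Longrightarrow> distr M borel (Wk k) = distr M borel W"
    and F_def: "F = sample_algebra M Wk"
    and R_meas: "\<And>k. R k \<in> borel_measurable M"
    and u0: "u0 \<in> Uad"
    and U_0: "\<And>\<omega>. \<omega> \<in> space M \<Longrightarrow> U 0 \<omega> = u0"
    and G_meas: "\<And>k. G k \<in> borel_measurable M"
    and G_subgrad: "\<And>k \<omega>. \<omega> \<in> space M \<Longrightarrow>
                      G k \<omega> \<in> subdifferential (\<lambda>u. jC u (Wk (Suc k) \<omega>)) (U k \<omega>)"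
    and objective_coercive: "\<And>k \<omega>. \<omega> \<in> space M \<Longrightarrow>
          coercive_on Uad
            (app_objective K dK jS (U k \<omega>) (\<epsilon> k) (G k \<omega> + R k \<omega>) (Wk (Suc k) \<omega>))"
    and U_Suc: "\<And>k \<omega> u. \<omega> \<in> space M \<Longrightarrow>
          is_arg_min
            (app_objective K dK jS (U k \<omega>) (\<epsilon> k) (G k \<omega> + R k \<omega>) (Wk (Suc k) \<omega>))
            (\<lambda>v. v \<in> Uad) u \<longleftrightarrow> u = U (Suc k) \<omega>"
    and U_adapted: "\<And>k. U k \<in> borel_measurable (F k)"
    \<comment> \<open>(a)\<close>
    and c_pos: "c1 > 0" "c2 > 0" and d_pos: "d1 > 0" "d2 > 0"
    and jC_bound: "\<And>u w r. u \<in> Uad \<Longrightarrow> r \<in> subdifferential (\<lambda>v. jC v w) u \<Longrightarrow>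
                     norm r \<le> c1 * norm u + c2"
    and jS_bound: "\<And>u w s. u \<in> Uad \<Longrightarrow> s \<in> subdifferential (\<lambda>v. jS v w) u \<Longrightarrow>
                     norm s \<le> d1 * norm u + d2"
    \<comment> \<open>(b)\<close>
    and J_coercive: "coercive_on Uad J"
    \<comment> \<open>(c)\<close>
    and b_pos: "b > 0"
    and K_strongly_convex: "\<And>u v. K v \<ge> K u + blinfun_apply (dK u) (v - u) + b / 2 * (norm (u - v))\<^sup>2"
    and L_K_pos: "L_K > 0"
    and dK_Lipschitz: "\<And>u v. norm (dK v - dK u) \<le> L_K * norm (v - u)"
    \<comment> \<open>(d)\<close>
    and eps_pos: "\<And>k. \<epsilon> k > 0"
    and eps_sum: "filterlim (\<lambda>n. \<Sum>k<n. \<epsilon> k) at_top sequentially"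
    and eps_sq_sum: "summable (\<lambda>k. (\<epsilon> k)\<^sup>2)"
    \<comment> \<open>(e)\<close>
    and R_adapted: "\<And>k. R k \<in> borel_measurable (F (Suc k))"
    and R_bounded: "AE \<omega> in M. bounded (range (\<lambda>k. R k \<omega>))"
    and R_cond: "AE \<omega> in M.
          (\<Sum>k. ennreal (\<epsilon> k) * nn_cond_exp M (F k) (\<lambda>\<omega>'. ennreal (norm (R k \<omega>'))) \<omega>) < \<infinity>"
    \<comment> \<open>(f)\<close>
    and minorant: "\<And>k. k \<ge> 1 \<Longrightarrow> \<exists>\<psi> :: 'a \<Rightarrow> real. integrable M \<psi> \<and>
          (\<forall>u. \<forall>\<omega>\<in>space M. \<psi> \<omega> \<le> jC u (Wk k \<omega>) + jS u (Wk k \<omega>))"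
    \<comment> \<open>(g)\<close>
    and R_esssup: "(\<Sum>k. esssup M (\<lambda>\<omega>. ennreal (norm (R k \<omega>))) * ennreal (\<epsilon> k)) < \<infinity>"
    \<comment> \<open>step sizes and minimizer\<close>
    and theta: "1 / 2 < \<theta>" "\<theta> < 1" and c_gt_0: "c > 0"
    and eps_eq: "\<And>k. k \<ge> 1 \<Longrightarrow> \<epsilon> k = c * real k powr (- \<theta>)"
    and u_sharp: "is_arg_min J (\<lambda>u. u \<in> Uad) u_sharp"
  shows "(\<forall>n\<ge>1. integrable M (\<lambda>\<omega>. J (averaged_iterate \<epsilon> U 1 n \<omega>) - J u_sharp)) \<and>
         (\<lambda>n. \<integral>\<omega>. (J (averaged_iterate \<epsilon> U 1 n \<omega>) - J u_sharp) \<partial>M)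
            \<in> O(\<lambda>n. real n powr (\<theta> - 1)) \<and>
         (\<forall>\<delta>>0. \<theta> \<le> 1 / 2 + \<delta> \<longrightarrow>
            (\<lambda>n. \<integral>\<omega>. (J (averaged_iterate \<epsilon> U 1 n \<omega>) - J u_sharp) \<partial>M)
              \<in> O(\<lambda>n. real n powr (- (1 / 2) + \<delta>)))"
proof -
  interpret prob_space M by (rule prob)
  define j where "j u w = jC u w + jS u w" for u w
  define A where "A = c1 + d1"
  define B where "B = c2 + d2"
  have AB: "0 \<le> A" "0 \<le> B" using c_pos d_pos by (auto simp: A_def B_def)
  have jC_lip: "jC u w - jC v w \<le> (c1 * norm u + c2) * norm (u - v)" if "u \<in> Uad" for u v w
  proof (rule subgradient_bound_imp_lipschitz[where f = "\<lambda>u. jC u w"])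
    show "subdifferential (\<lambda>u. jC u w) u \<noteq> {}" using jC_subdiff[of w] that by blast
  qed (rule jC_bound[OF that])
  have jS_lip: "jS u w - jS v w \<le> (d1 * norm u + d2) * norm (u - v)" if "u \<in> Uad" for u v w
  proof (rule subgradient_bound_imp_lipschitz[where f = "\<lambda>u. jS u w"])
    show "subdifferential (\<lambda>u. jS u w) u \<noteq> {}"
      by (rule subdifferential_nonempty[OF jS_convex lower_semicontinuous_section[OF jS_lsc]])
  qed (rule jS_bound[OF that])
  have j_lip: "j u w - j v w \<le> (A * norm u + B) * norm (u - v)" if "u \<in> Uad" "v \<in> Uad" for u v w
    using jC_lip[OF that(1), of w v] jS_lip[OF that(1), of w v]
    by (simp add: j_def A_def B_def algebra_simps)
  have j_meas: "(\<lambda>(u, w). j u w) \<in> borel_measurable (borel \<Otimes>\<^sub>M borel)"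
    using lower_semicontinuous_measurable_pair[OF jC_lsc] lower_semicontinuous_measurable_pair[OF jS_lsc]
    by (simp add: j_def case_prod_beta')
  have j_int: "integrable M (\<lambda>\<omega>. j u (W \<omega>))" if "u \<in> Uad" for u
    using jC_integrable[OF that] jS_integrable[OF that] by (simp add: j_def)
  have J_eq: "J u = expected_cost M W j u" if "u \<in> Uad" for u
    using jC_integrable[OF that] jS_integrable[OF that]
    by (simp add: J_def JC_def JS_def expected_cost_def j_def)
  have us: "u_sharp \<in> Uad" and J_min: "\<And>u. u \<in> Uad \<Longrightarrow> J u_sharp \<le> J u"
    using u_sharp by (auto simp: is_arg_min_linorder)
  have J_lip: "J u - J v \<le> (A * norm u + B) * norm (u - v)" if "u \<in> Uad" "v \<in> Uad" for u v
    unfolding J_eq[OF that(1)] J_eq[OF that(2)]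
    by (rule expected_cost_lipschitz[where S = Uad]) (use that j_int j_lip in auto)
  have J_cont: "continuous_on Uad J"
    using J_lip by (rule linear_growth_lipschitz_continuous_on)
  have J_convex: "convex_on Uad J"
  proof -
    have "convex_on Uad (\<lambda>u. j u w)" for w
      unfolding j_def
      by (rule convex_on_add; rule convex_on_subset[OF _ subset_UNIV Uad(3)]) (rule jC_convex jS_convex)+
    from convex_on_expected_cost[where j = j and W = W and S = Uad and M = M, OF Uad(3) j_int this]
    have "convex_on Uad (expected_cost M W j)" .
    then show ?thesis using J_eq convexD[OF Uad(3)] unfolding convex_on_def by simp
  qed

  have Wk_meas: "Wk i \<in> borel_measurable M" if "i \<ge> 1" for i
    using Wk_indep that unfolding indep_vars_def2 by auto
  have U_meas: "U k \<in> borel_measurable M" for k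
    using sample_algebra_subalgebra[where X = Wk, OF Wk_meas] U_adapted unfolding F_def
    by (rule measurable_from_subalg)
  have U_Uad: "U k \<omega> \<in> Uad" if "\<omega> \<in> space M" for k \<omega>
  proof (cases k)
    case 0 then show ?thesis using U_0[OF that] u0 by simp
  next
    case (Suc l) then show ?thesis using U_Suc[OF that, of l "U (Suc l) \<omega>"] by (simp add: is_arg_min_def)
  qed

  \<comment> \<open>\<open>V\<close> is the energy, \<open>D\<close> the cost gap on the sample drawn after \<open>U k\<close>, and \<open>q\<close> the
    essential bound on the additive error, as a real number.\<close>
  define V where "V k \<omega> = bregman K dK u_sharp (U k \<omega>)" for k \<omega>
  define D where "D k \<omega> = j (U k \<omega>) (Wk (Suc k) \<omega>) - j u_sharp (Wk (Suc k) \<omega>)" for k \<omega>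
  define q where "q k = enn2real (esssup M (\<lambda>\<omega>. ennreal (norm (R k \<omega>))))" for k
  have q_nonneg: "0 \<le> q k" for k by (simp add: q_def)
  have q: "ennreal (q k) = esssup M (\<lambda>\<omega>. ennreal (norm (R k \<omega>)))" for k
  proof -
    let ?t = "\<lambda>k. esssup M (\<lambda>\<omega>. ennreal (norm (R k \<omega>))) * ennreal (\<epsilon> k)"
    have "?t k \<le> (\<Sum>k. ?t k)" using sum_le_suminf[of ?t "{k}"] by simp
    then have "?t k < \<infinity>" using R_esssup by (rule le_less_trans)
    then have "esssup M (\<lambda>\<omega>. ennreal (norm (R k \<omega>))) < top"
      using eps_pos[of k] by (auto simp: ennreal_mult_less_top)
    then show ?thesis by (simp add: q_def)
  qed
  have R_le: "AE \<omega> in M. norm (R k \<omega>) \<le> q k" for k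
    using esssup_AE[of "\<lambda>\<omega>. ennreal (norm (R k \<omega>))" M] unfolding q[symmetric]
    by (simp add: q_nonneg)
  have q_summable: "summable (\<lambda>k. \<epsilon> k * q k)"
  proof (rule summable_suminf_not_top)
    show "0 \<le> \<epsilon> k * q k" for k using eps_pos[of k] q_nonneg[of k] by simp
    have "ennreal (\<epsilon> k * q k) = esssup M (\<lambda>\<omega>. ennreal (norm (R k \<omega>))) * ennreal (\<epsilon> k)" for k
      unfolding q[symmetric] using eps_pos[of k] q_nonneg[of k] by (simp add: ennreal_mult mult.commute)
    then show "(\<Sum>k. ennreal (\<epsilon> k * q k)) \<noteq> top" using R_esssup by simp
  qed
  \<comment> \<open>\<open>B'\<close> rewrites the growth bound in terms of the distance to \<open>u_sharp\<close>; \<open>a\<close> and \<open>r\<close> are the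
    coefficients produced by \<open>absorb_into_energy\<close>.\<close>
  define B' where "B' = A * norm u_sharp + B"
  define a where "a k = 2 / b * (\<epsilon> k * q k + 3 * A\<^sup>2 * (\<epsilon> k)\<^sup>2 / (2 * b))" for k
  define r where "r k = \<epsilon> k * q k + (3 * B'\<^sup>2 * (\<epsilon> k)\<^sup>2 + 3 * (\<epsilon> k * q k)\<^sup>2) / (2 * b)" for k
  have a_nonneg: "0 \<le> a k" and r_nonneg: "0 \<le> r k" for k
    using eps_pos[of k] q_nonneg[of k] b_pos by (auto simp: a_def r_def)
  have a_summable: "summable a" unfolding a_def
    by (intro summable_mult summable_add summable_divide q_summable eps_sq_sum)
  have "summable (\<lambda>k. (\<epsilon> k * q k)\<^sup>2)"
    using q_summable by (rule summable_power2_of_nonneg) (use eps_pos q_nonneg in \<open>simp add: less_imp_le\<close>)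
  then have r_summable: "summable r" unfolding r_def
    by (intro summable_mult summable_add summable_divide q_summable eps_sq_sum)

  have V_lower: "b / 2 * (norm (U k \<omega> - u_sharp))\<^sup>2 \<le> V k \<omega>" for k \<omega>
    using K_strongly_convex[of "U k \<omega>" u_sharp] by (simp add: V_def bregman_def)
  have V_nonneg: "0 \<le> V k \<omega>" for k \<omega>
    using V_lower[of k \<omega>] b_pos by (smt (verit) mult_nonneg_nonneg half_gt_zero zero_le_power2)
  have V_meas: "V k \<in> borel_measurable M" for k
  proof -
    have "L_K-lipschitz_on UNIV dK"
      using dK_Lipschitz L_K_pos by (intro lipschitz_onI) (auto simp: dist_norm)
    then have "continuous_on UNIV dK" by (rule lipschitz_on_continuous_on)
    then have "continuous_on UNIV (\<lambda>u. blinfun_apply (dK u) (u_sharp - u))"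
      by (intro continuous_intros)
    then have "(\<lambda>u. blinfun_apply (dK u) (u_sharp - u)) \<in> borel_measurable borel"
      by (rule borel_measurable_continuous_onI)
    then have "bregman K dK u_sharp \<in> borel_measurable borel"
      unfolding bregman_def using lower_semicontinuous_measurable[OF K_lsc] by measurable
    from measurable_compose[OF U_meas this] show ?thesis by (simp add: V_def[abs_def])
  qed
  have U_sq: "integrable M (\<lambda>\<omega>. (norm (U k \<omega>))\<^sup>2)" if V: "integrable M (V k)" for k
  proof (rule Bochner_Integration.integrable_bound)
    show "integrable M (\<lambda>\<omega>. 4 / b * V k \<omega> + 2 * (norm u_sharp)\<^sup>2)" using V by simp
    show "(\<lambda>\<omega>. (norm (U k \<omega>))\<^sup>2) \<in> borel_measurable M" using U_meas by measurable
    show "AE \<omega> in M. norm ((norm (U k \<omega>))\<^sup>2) \<le> norm (4 / b * V k \<omega> + 2 * (norm u_sharp)\<^sup>2)"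
    proof (rule AE_I2)
      fix \<omega>
      let ?s = "norm (U k \<omega> - u_sharp)" and ?v = "norm u_sharp"
      have "(norm (U k \<omega>))\<^sup>2 \<le> (?s + ?v)\<^sup>2"
        using norm_triangle_ineq[of "U k \<omega> - u_sharp" u_sharp] by (intro power_mono) auto
      also have "\<dots> \<le> 2 * ?s\<^sup>2 + 2 * ?v\<^sup>2"
        using sum_power2_ge_zero[of "?s - ?v" 0] by (simp add: power2_sum power2_diff)
      also have "2 * ?s\<^sup>2 \<le> 4 / b * V k \<omega>"
        using V_lower[of k \<omega>] b_pos by (simp add: field_simps)
      finally show "norm ((norm (U k \<omega>))\<^sup>2) \<le> norm (4 / b * V k \<omega> + 2 * ?v\<^sup>2)" by simp
    qed
  qed
  have V_0: "integrable M (V 0)"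
  proof -
    have "integrable M (V 0) \<longleftrightarrow> integrable M (\<lambda>_. bregman K dK u_sharp u0)"
      by (rule Bochner_Integration.integrable_cong) (simp_all add: V_def U_0)
    then show ?thesis by simp
  qed
  have gap:
      "integrable M (D k)"
      "integrable M (\<lambda>\<omega>. J (U k \<omega>) - J u_sharp)"
      "(\<integral>\<omega>. D k \<omega> \<partial>M) = (\<integral>\<omega>. (J (U k \<omega>) - J u_sharp) \<partial>M)"
    if V: "integrable M (V k)" for k
  proof -
    have ind: "prob ((U k -` C \<inter> space M) \<inter> (Wk (Suc k) -` E \<inter> space M))
        = prob (U k -` C \<inter> space M) * prob (Wk (Suc k) -` E \<inter> space M)"
      if "C \<in> sets borel" "E \<in> sets borel" for C E
      using Wk_indep U_adapted[of k, unfolded F_def] that by (rule adapted_indep_of_next_sample)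
    have Y: "Wk (Suc k) \<in> borel_measurable M" "distr M borel (Wk (Suc k)) = distr M borel W"
      using Wk_meas Wk_distr by auto
    note * = expectation_fresh_sample_gap[where X = "U k" and Y = "Wk (Suc k)" and W = W and j = j
        and S = Uad and v = u_sharp and A = A and B = B,
        OF U_meas Y(1) W_rv ind Y(2) j_meas j_int j_lip AB U_Uad us U_sq[OF V]]
    have Dk: "integrable M (\<lambda>\<omega>. j (U k \<omega>) (Wk (Suc k) \<omega>) - j u_sharp (Wk (Suc k) \<omega>))" by (rule *(1))
    show "integrable M (D k)" using Dk unfolding D_def .
    have eq: "expected_cost M W j (U k \<omega>) - expected_cost M W j u_sharp = J (U k \<omega>) - J u_sharp"
      if "\<omega> \<in> space M" for \<omega>
      using J_eq[OF U_Uad[OF that]] J_eq[OF us] by simp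
    show "integrable M (\<lambda>\<omega>. J (U k \<omega>) - J u_sharp)"
      by (rule iffD1[OF Bochner_Integration.integrable_cong[OF refl eq] *(2)])
    show "(\<integral>\<omega>. D k \<omega> \<partial>M) = (\<integral>\<omega>. (J (U k \<omega>) - J u_sharp) \<partial>M)"
      unfolding D_def by (rule trans[OF *(3) Bochner_Integration.integral_cong[OF refl eq]])
  qed
  have gap_nonneg: "0 \<le> (\<integral>\<omega>. (J (U k \<omega>) - J u_sharp) \<partial>M)" for k
    using J_min U_Uad by (intro integral_nonneg_AE AE_I2) simp
  have step: "AE \<omega> in M. V (Suc k) \<omega> + \<epsilon> k * D k \<omega> \<le> (1 + a k) * V k \<omega> + r k" for k
    using R_le[of k] AE_space
  proof eventually_elim
    case (elim \<omega>)
    let ?x = "U k \<omega>" and ?y = "U (Suc k) \<omega>" and ?w = "Wk (Suc k) \<omega>"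
    let ?p = "\<epsilon> k *\<^sub>R (G k \<omega> + R k \<omega>) - dK ?x"
    have e: "0 \<le> \<epsilon> k" using eps_pos[of k] by simp
    have x: "?x \<in> Uad" using U_Uad elim by blast
    have "app_objective K dK jS ?x (\<epsilon> k) (G k \<omega> + R k \<omega>) ?w
        = (\<lambda>v. K v + blinfun_apply ?p v + \<epsilon> k * jS v ?w)"
      by (simp add: app_objective_def fun_eq_iff)
    then have "is_arg_min (\<lambda>v. K v + blinfun_apply ?p v + \<epsilon> k * jS v ?w) (\<lambda>v. v \<in> Uad) ?y"
      using U_Suc[of \<omega> k ?y] elim by simp
    from minimizer_variational_inequality[OF Uad(3) jS_convex e K_gateaux this us]
    have opt: "0 \<le> blinfun_apply (dK ?y - dK ?x + \<epsilon> k *\<^sub>R (G k \<omega> + R k \<omega>)) (u_sharp - ?y)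
        + \<epsilon> k * (jS u_sharp ?w - jS ?y ?w)"
      by (simp add: algebra_simps)
    define L where "L = (c1 * norm ?x + c2) + (d1 * norm ?x + d2)"
    have "V (Suc k) \<omega> + \<epsilon> k * D k \<omega>
        \<le> V k \<omega> + \<epsilon> k * q k * norm (?x - u_sharp) + (\<epsilon> k * (L + q k))\<^sup>2 / (2 * b)"
      unfolding V_def D_def j_def L_def
    proof (rule one_step_decrease[where f = "\<lambda>u. jC u ?w" and s = "\<lambda>u. jS u ?w", OF b_pos e _ opt _ _ _ elim(1)])
      show "G k \<omega> \<in> subdifferential (\<lambda>u. jC u ?w) ?x" using G_subgrad elim by blast
      then show "norm (G k \<omega>) \<le> c1 * norm ?x + c2" by (rule jC_bound[OF x])
      show "jS ?x ?w - jS ?y ?w \<le> (d1 * norm ?x + d2) * norm (?x - ?y)" by (rule jS_lip[OF x])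
    qed (rule K_strongly_convex)
    also have "\<dots> \<le> (1 + a k) * V k \<omega> + r k"
      unfolding a_def r_def
    proof (rule absorb_into_energy[OF b_pos e q_nonneg _ _ V_lower])
      show "0 \<le> L" using c_pos d_pos by (simp add: L_def)
      have "A * norm ?x \<le> A * (norm (?x - u_sharp) + norm u_sharp)"
        using norm_triangle_ineq[of "?x - u_sharp" u_sharp] AB by (intro mult_left_mono) auto
      then show "L \<le> A * norm (?x - u_sharp) + B'"
        by (simp add: L_def A_def B_def B'_def algebra_simps)
    qed simp
    finally show ?case .
  qed
  define C where "C = exp (suminf a) * ((\<integral>\<omega>. V 0 \<omega> \<partial>M) + suminf r)"
  have D_nonneg: "0 \<le> (\<integral>\<omega>. D k \<omega> \<partial>M)" if "integrable M (V k)" for k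
    unfolding gap(3)[OF that] by (rule gap_nonneg)
  note rec = expected_energy_recursion[where V = V and D = D and e = \<epsilon> and a = a and c = r, OF V_meas V_0 V_nonneg gap(1) D_nonneg step
      less_imp_le[OF eps_pos] a_nonneg r_nonneg a_summable r_summable]
  have V_int: "integrable M (V k)" for k by (rule rec(1))
  have sum_gap: "(\<Sum>k<n. \<epsilon> k * (\<integral>\<omega>. (J (U k \<omega>) - J u_sharp) \<partial>M)) \<le> C" for n
    using rec(2)[of n] unfolding gap(3)[OF V_int] C_def .
  have C_nonneg: "0 \<le> C" using sum_gap[of 0] by simp

  let ?gap = "\<lambda>n. \<integral>\<omega>. (J (averaged_iterate \<epsilon> U 1 n \<omega>) - J u_sharp) \<partial>M"
  have avg: "integrable M (\<lambda>\<omega>. J (averaged_iterate \<epsilon> U 1 n \<omega>) - J u_sharp)"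
      "0 \<le> ?gap n" "?gap n \<le> C / c * real n powr (\<theta> - 1)" if n: "1 \<le> n" for n
  proof -
    note * = averaged_iterate_expected_gap[where U = U and \<epsilon> = \<epsilon> and S = Uad and f = J
        and m = "J u_sharp", OF eps_pos n Uad(3) J_convex J_cont U_meas U_Uad J_min gap(2)[OF V_int]]
    show "integrable M (\<lambda>\<omega>. J (averaged_iterate \<epsilon> U 1 n \<omega>) - J u_sharp)"
      by (rule *(1))
    show "0 \<le> ?gap n" by (rule *(2))
    let ?\<Delta> = "\<lambda>k. \<epsilon> k * (\<integral>\<omega>. (J (U k \<omega>) - J u_sharp) \<partial>M)"
    \<comment> \<open>The recursion starts at index 0, the average at index 1; the extra term is nonnegative.\<close>
    have "(\<Sum>k=1..n. ?\<Delta> k) \<le> (\<Sum>k<Suc n. ?\<Delta> k)"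
      by (intro sum_mono2 mult_nonneg_nonneg less_imp_le[OF eps_pos] gap_nonneg) auto
    also have "\<dots> \<le> C" by (rule sum_gap)
    finally have num: "(\<Sum>k=1..n. ?\<Delta> k) \<le> C" .
    have den: "c * real n powr (1 - \<theta>) \<le> (\<Sum>k=1..n. \<epsilon> k)"
      using theta by (intro sum_powr_lower_bound c_gt_0 n eps_eq) auto
    have pos: "0 < c * real n powr (1 - \<theta>)" using c_gt_0 n by simp
    have "?gap n \<le> (\<Sum>k=1..n. ?\<Delta> k) / (\<Sum>k=1..n. \<epsilon> k)" by (rule *(3))
    also have "\<dots> \<le> C / (c * real n powr (1 - \<theta>))"
      using num den pos C_nonneg by (intro frac_le) auto
    also have "\<dots> = C / c * real n powr (\<theta> - 1)"
      using powr_minus_divide[of "real n" "1 - \<theta>"] by simp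
    finally show "?gap n \<le> C / c * real n powr (\<theta> - 1)" .
  qed
  have rate: "?gap \<in> O(\<lambda>n. real n powr (\<theta> - 1))"
  proof (rule bigoI[of _ "C / c"])
    show "eventually (\<lambda>n. norm (?gap n) \<le> C / c * norm (real n powr (\<theta> - 1))) sequentially"
      using eventually_ge_at_top[of 1] by eventually_elim (use avg(2,3) in simp)
  qed
  have "?gap \<in> O(\<lambda>n. real n powr (- (1 / 2) + \<delta>))" if "\<theta> \<le> 1 / 2 + \<delta>" for \<delta>
  proof (rule landau_o.big_trans[OF rate], rule bigoI[of _ 1])
    show "eventually (\<lambda>n. norm (real n powr (\<theta> - 1)) \<le> 1 * norm (real n powr (- (1 / 2) + \<delta>))) sequentially"
      using eventually_ge_at_top[of 1]
      by eventually_elim (use that in \<open>auto intro!: powr_mono\<close>)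
  qed
  then show ?thesis using avg(1) rate by blast
qed

end
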